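(* Let $M\ge1$ be an integer, $N\ge0$, $\tau>0$, $G=\cosh^2\tau$, and let $\mathcal A_G$ be the single-mode quantum-limited amplifier channel of gain $G$. Let $|\psi\rangle_{AS}=\sum_{\mathbf n\ge\mathbf 0}\sqrt{p_{\mathbf n}}\,|\chi_{\mathbf n}\rangle_A|\mathbf n\rangle_S$ with $\{|\chi_{\mathbf n}\rangle_A\}$ orthonormal, $|\mathbf n\rangle_S$ number states of $M$ signal modes, and $\{p_{\mathbf n}\}$ a probability distribution with $\sum_{\mathbf n}p_{\mathbf n}(n_1+\cdots+n_M)=N$. Measure the output $(\mathrm{id}_A\otimes\mathcal A_G^{\otimes M})(|\psi\rangle\langle\psi|)$ in the basis $\{|\chi_{\mathbf x}\rangle\}$ on $A$ (outcome $\mathbf X$) and in photon number on each of the $M$ signal modes (outcome $\mathbf Y$). Then the classical Fisher information on $\tau$ of the joint distribution of $(\mathbf X,\mathbf Y)$ is $$\mathcal J_\tau[\mathbf X,\mathbf Y]=4(N+M),$$ so this ($G$-independent) measurement attains the quantum Fisher information $\mathcal K_\tau=4(N+M)$ of the output state family.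
   Context: The quantum-limited amplifier $\mathcal A_G$, $G=\cosh^2\tau\ge1$, acts on a signal mode by a two-mode squeezing unitary $\hat U(\tau)$ with a vacuum environment mode $E$ that is then traced out, where $\hat U(\tau)|n\rangle_S|0\rangle_E=\mathrm{sech}^{\,n+1}\tau\sum_{a=0}^\infty\sqrt{\binom{n+a}{a}}\tanh^a\tau\,|n+a\rangle_S|a\rangle_E$. The classical Fisher information of a family of probability mass functions $P(z;\tau)$ is $\mathcal J_\tau=\sum_zP(z;\tau)[\partial_\tau\ln P(z;\tau)]^2$. The quantum Fisher information of a family $\rho_\tau$ is $\mathcal K_\tau=\mathrm{Tr}[\rho_\tau\hat L_\tau^2]$ with $\partial_\tau\rho_\tau=\frac12(\hat L_\tau\rho_\tau+\rho_\tau\hat L_\tau)$, computed as $-4\,\partial^2_{\tau'}\mathcal F(\rho_\tau,\rho_{\tau'})|_{\tau'=\tau}$ with $\mathcal F(\rho,\sigma)=\mathrm{Tr}\sqrt{\sqrt\rho\,\sigma\sqrt\rho}$. *)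

theory Defs
  imports "HOL-Analysis.Analysis"
begin

(* A Hilbert space with orthonormal basis indexed by the type 'i is represented as the space of
   square-summable functions 'i => complex.  The tensor product of the spaces over 'i and 'j is the
   space over 'i \<times> 'j.  The ancilla is the space over an arbitrary type 'a, a bosonic mode is the
   space over nat (number states), and M = CARD('m) modes are the space over 'm => nat. *)

section \<open>Vectors\<close>

definition ell2 :: "('i \<Rightarrow> complex) set" where
  "ell2 = {x. (\<lambda>i. (cmod (x i))\<^sup>2) summable_on UNIV}"

definition ell2_norm :: "('i \<Rightarrow> complex) \<Rightarrow> real" where
  "ell2_norm x = sqrt (\<Sum>\<^sub>\<infinity>i. (cmod (x i))\<^sup>2)"

definition cinner :: "('i \<Rightarrow> complex) \<Rightarrow> ('i \<Rightarrow> complex) \<Rightarrow> complex" where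
  "cinner x y = (\<Sum>\<^sub>\<infinity>i. cnj (x i) * y i)"

definition ket :: "'i \<Rightarrow> 'i \<Rightarrow> complex" where
  "ket i = (\<lambda>j. of_bool (j = i))"

definition tensor :: "('i \<Rightarrow> complex) \<Rightarrow> ('j \<Rightarrow> complex) \<Rightarrow> 'i \<times> 'j \<Rightarrow> complex" where
  "tensor x y = (\<lambda>(i, j). x i * y j)"

definition orthonormal_family :: "('k \<Rightarrow> 'i \<Rightarrow> complex) \<Rightarrow> bool" where
  "orthonormal_family v \<longleftrightarrow>
     (\<forall>k. v k \<in> ell2) \<and> (\<forall>k l. cinner (v k) (v l) = of_bool (k = l))"

section \<open>Operators given by matrices\<close>

type_synonym ('i, 'j) cmat = "'i \<Rightarrow> 'j \<Rightarrow> complex"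

definition mat_app :: "('i, 'j) cmat \<Rightarrow> ('j \<Rightarrow> complex) \<Rightarrow> 'i \<Rightarrow> complex" where
  "mat_app A x = (\<lambda>i. \<Sum>\<^sub>\<infinity>j. A i j * x j)"

definition mat_mult :: "('i, 'j) cmat \<Rightarrow> ('j, 'k) cmat \<Rightarrow> ('i, 'k) cmat" where
  "mat_mult A B = (\<lambda>i k. \<Sum>\<^sub>\<infinity>j. A i j * B j k)"

definition adjoint :: "('i, 'j) cmat \<Rightarrow> ('j, 'i) cmat" where
  "adjoint A = (\<lambda>j i. cnj (A i j))"

definition ketbra :: "('i \<Rightarrow> complex) \<Rightarrow> ('i \<Rightarrow> complex) \<Rightarrow> ('i, 'i) cmat" where
  "ketbra x y = (\<lambda>i j. x i * cnj (y j))"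

definition partial_trace_snd :: "('i \<times> 'e, 'i \<times> 'e) cmat \<Rightarrow> ('i, 'i) cmat" where
  "partial_trace_snd A = (\<lambda>i j. \<Sum>\<^sub>\<infinity>e. A (i, e) (j, e))"

definition bounded_op :: "('i, 'i) cmat \<Rightarrow> bool" where
  "bounded_op A \<longleftrightarrow> (\<exists>C. \<forall>x\<in>ell2.
     (\<forall>i. (\<lambda>j. A i j * x j) summable_on UNIV) \<and>
     mat_app A x \<in> ell2 \<and> ell2_norm (mat_app A x) \<le> C * ell2_norm x)"

(* R is the positive square root of A *)
definition is_positive_sqrt :: "('i, 'i) cmat \<Rightarrow> ('i, 'i) cmat \<Rightarrow> bool" where
  "is_positive_sqrt R A \<longleftrightarrow>
     bounded_op R \<and> (\<forall>x\<in>ell2. cinner x (mat_app R x) \<in> \<real>\<^sub>\<ge>\<^sub>0) \<and> mat_mult R R = A"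

section \<open>The quantum-limited amplifier\<close>

(* The isometry |n>_S |-> U(tau) |n>_S |0>_E as a matrix: the entry in row (k, a) and column n is
   the coefficient of |k>_S |a>_E in U(tau) |n>_S |0>_E. *)
definition squeeze_vacuum :: "real \<Rightarrow> (nat \<times> nat, nat) cmat" where
  "squeeze_vacuum \<tau> = (\<lambda>(k, a) n.
     if k = n + a
     then complex_of_real ((1 / cosh \<tau>) ^ (n + 1) * sqrt (real ((n + a) choose a)) * tanh \<tau> ^ a)
     else 0)"

(* arcosh (sqrt G) is the tau \<ge> 0 with G = (cosh tau)^2. *)
definition amplifier :: "real \<Rightarrow> (nat, nat) cmat \<Rightarrow> (nat, nat) cmat" where
  "amplifier G \<rho> =
     (let V = squeeze_vacuum (arcosh (sqrt G))
      in partial_trace_snd (mat_mult (mat_mult V \<rho>) (adjoint V)))"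

(* id_A \<otimes> Phi^{\<otimes>M}, by linear extension from the matrix units
   |alpha><beta| \<otimes> |n_1><m_1| \<otimes> ... \<otimes> |n_M><m_M|.
   For the amplifier, only finitely many terms of each sum are nonzero. *)
definition id_tensor_power ::
  "((nat, nat) cmat \<Rightarrow> (nat, nat) cmat) \<Rightarrow>
   ('a \<times> ('m::finite \<Rightarrow> nat), 'a \<times> ('m \<Rightarrow> nat)) cmat \<Rightarrow>
   ('a \<times> ('m \<Rightarrow> nat), 'a \<times> ('m \<Rightarrow> nat)) cmat" where
  "id_tensor_power \<Phi> \<rho> = (\<lambda>(\<alpha>, y) (\<beta>, z).
     \<Sum>\<^sub>\<infinity>(n, m). (\<Prod>i\<in>UNIV. \<Phi> (ketbra (ket (n i)) (ket (m i))) (y i) (z i)) * \<rho> (\<alpha>, n) (\<beta>, m))"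

(* sum_n sqrt (p n) (chi n \<otimes> |n>); for each argument at most one term is nonzero. *)
definition probe_state ::
  "(('m::finite \<Rightarrow> nat) \<Rightarrow> real) \<Rightarrow> (('m \<Rightarrow> nat) \<Rightarrow> 'a \<Rightarrow> complex) \<Rightarrow>
   'a \<times> ('m \<Rightarrow> nat) \<Rightarrow> complex" where
  "probe_state p chi = (\<lambda>k. \<Sum>\<^sub>\<infinity>n. complex_of_real (sqrt (p n)) * tensor (chi n) (ket n) k)"

definition output_state ::
  "(('m::finite \<Rightarrow> nat) \<Rightarrow> real) \<Rightarrow> (('m \<Rightarrow> nat) \<Rightarrow> 'a \<Rightarrow> complex) \<Rightarrow> real \<Rightarrow>
   ('a \<times> ('m \<Rightarrow> nat), 'a \<times> ('m \<Rightarrow> nat)) cmat" where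
  "output_state p chi G =
     id_tensor_power (amplifier G) (ketbra (probe_state p chi) (probe_state p chi))"

section \<open>The measurement and its Fisher information\<close>

(* Probability of the outcome (x, y) when A is measured in {chi x} and the modes in photon number. *)
definition joint_distribution ::
  "('k \<Rightarrow> 'a \<Rightarrow> complex) \<Rightarrow> ('a \<times> ('m::finite \<Rightarrow> nat), 'a \<times> ('m \<Rightarrow> nat)) cmat \<Rightarrow>
   'k \<times> ('m \<Rightarrow> nat) \<Rightarrow> real" where
  "joint_distribution chi \<rho> = (\<lambda>(x, y).
     let v = tensor (chi x) (ket y) in Re (cinner v (mat_app \<rho> v)))"

definition is_pmf :: "('z \<Rightarrow> real) \<Rightarrow> bool" where
  "is_pmf P \<longleftrightarrow> (\<forall>z. 0 \<le> P z) \<and> (P has_sum 1) UNIV"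

(* Outcomes of probability 0 contribute 0. *)
definition has_classical_fisher_information :: "(real \<Rightarrow> 'z \<Rightarrow> real) \<Rightarrow> real \<Rightarrow> real \<Rightarrow> bool" where
  "has_classical_fisher_information P \<tau> J \<longleftrightarrow>
     (\<forall>\<^sub>F t in nhds \<tau>. is_pmf (P t)) \<and>
     (\<forall>z. (\<lambda>t. P t z) differentiable (at \<tau>)) \<and>
     ((\<lambda>z. P \<tau> z * (deriv (\<lambda>t. ln (P t z)) \<tau>)\<^sup>2) has_sum J) UNIV"

section \<open>Quantum Fisher information\<close>

(* A densely defined symmetric operator L with domain D.  The symmetric logarithmic derivative of
   a family in infinite dimension is in general unbounded. *)
definition symmetric_operator ::
  "('i \<Rightarrow> complex) set \<Rightarrow> (('i \<Rightarrow> complex) \<Rightarrow> 'i \<Rightarrow> complex) \<Rightarrow> bool" where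
  "symmetric_operator D L \<longleftrightarrow>
     D \<subseteq> ell2 \<and> (\<lambda>i. 0) \<in> D \<and>
     (\<forall>x\<in>D. \<forall>y\<in>D. (\<lambda>i. x i + y i) \<in> D \<and> L (\<lambda>i. x i + y i) = (\<lambda>i. L x i + L y i)) \<and>
     (\<forall>c. \<forall>x\<in>D. (\<lambda>i. c * x i) \<in> D \<and> L (\<lambda>i. c * x i) = (\<lambda>i. c * L x i)) \<and>
     (\<forall>x\<in>ell2. \<forall>\<epsilon>>0. \<exists>y\<in>D. ell2_norm (\<lambda>i. x i - y i) < \<epsilon>) \<and>
     (\<forall>x\<in>D. L x \<in> ell2) \<and>
     (\<forall>x\<in>D. \<forall>y\<in>D. cinner x (L y) = cinner (L x) y)"

(* d rho / d tau = (L rho + rho L) / 2, entry by entry.  Since L and rho are symmetric, rho L is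
   the adjoint of L rho; the (i, j) entry of L rho is L (rho |j>) i. *)
definition is_sld ::
  "(real \<Rightarrow> ('i, 'i) cmat) \<Rightarrow> real \<Rightarrow> ('i \<Rightarrow> complex) set \<Rightarrow>
   (('i \<Rightarrow> complex) \<Rightarrow> 'i \<Rightarrow> complex) \<Rightarrow> bool" where
  "is_sld \<rho> \<tau> D L \<longleftrightarrow>
     symmetric_operator D L \<and>
     (\<forall>x\<in>ell2. mat_app (\<rho> \<tau>) x \<in> D) \<and>
     (let L\<rho> = (\<lambda>i j. L (mat_app (\<rho> \<tau>) (ket j)) i)
      in \<forall>i j. ((\<lambda>t. \<rho> t i j) has_vector_derivative (L\<rho> i j + adjoint L\<rho> i j) / 2) (at \<tau>))"

(* K = Tr (rho L^2).  For unbounded L this trace is Tr (sqrt rho L^2 sqrt rho), the squared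
   Hilbert-Schmidt norm of L sqrt rho.  K is unique: L is determined on the range of sqrt rho. *)
definition has_quantum_fisher_information ::
  "(real \<Rightarrow> ('i, 'i) cmat) \<Rightarrow> real \<Rightarrow> real \<Rightarrow> bool" where
  "has_quantum_fisher_information \<rho> \<tau> K \<longleftrightarrow>
     (\<exists>D L R. is_sld \<rho> \<tau> D L \<and> is_positive_sqrt R (\<rho> \<tau>) \<and>
        (\<forall>x\<in>ell2. mat_app R x \<in> D) \<and>
        ((\<lambda>i. (ell2_norm (L (mat_app R (ket i))))\<^sup>2) has_sum K) UNIV)"

end

(*
  The ancilla label n and the measured photon number y = n + a together determine the number a of
  photon pairs created, and the vectors chi n (x) |n + a> are orthonormal. In their span
  the output state is the mixture over a of the mutually orthogonal branches with coefficients
  sqrt (p n) F(n, a), where F(n, a) is a product of square roots of negative binomial weights. Hence a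
  symmetric logarithmic derivative is diagonal in this basis, with entries twice the derivative of
  ln F(n, a): the measurement is optimal, and both Fisher informations equal four times the expected
  squared score. Each mode contributes an independent centred score of variance n_i + 1.
*)

theory Submission
  imports Defs "HOL-Library.Function_Algebras"
begin


section \<open>Square-summable functions\<close>

text \<open>The unnormalized branch vector |b_a> has norm \<open>weight a\<close>, so |b_a><b_a| has
  the positive root |b_a><b_a| / \<open>weight a\<close>: rescaling each branch gives the root of
  the whole state. The weights need not be bounded away from zero, so the estimates always pair a
  factor 1 / \<open>weight a\<close> with a factor \<open>weight a\<close>. Multiplying the
  coefficients of |b_a> by the real function \<open>\<mu>\<close> gives twice the derivative of
  |b_a>, and the product rule for |b_a><b_a| is then the defining equation of the logarithmic
  derivative. Since the score grows without bound in a, this operator needs a domain, a density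
  argument and a trace read as a Hilbert-Schmidt norm. In that norm the sum over basis vectors is
  taken first; it cancels the weights and leaves the sum of (\<open>\<mu>\<close> q)^2, which is
  also the classical expression. Convergence is kept under control by y = n + a: for fixed y only
  finitely many pairs (n, a) occur, so matrix entries and their derivatives are finite sums, and
  infinite sums remain only in norms, inner products and moments.\<close>

lemma ell2_summable: "x \<in> ell2 \<Longrightarrow> (\<lambda>i. (cmod (x i))\<^sup>2) summable_on UNIV"
  by (simp add: ell2_def)

lemma ell2_norm_nonneg: "0 \<le> ell2_norm x"
  by (simp add: ell2_norm_def infsum_nonneg)

lemma ell2_norm_power2: "(ell2_norm x)\<^sup>2 = (\<Sum>\<^sub>\<infinity>i. (cmod (x i))\<^sup>2)"
  by (simp add: ell2_norm_def infsum_nonneg)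

lemma has_sum_ell2_norm: "x \<in> ell2 \<Longrightarrow> ((\<lambda>i. (cmod (x i))\<^sup>2) has_sum (ell2_norm x)\<^sup>2) UNIV"
  by (simp add: ell2_norm_power2 ell2_summable)

lemma has_sum_imp_ell2: "((\<lambda>i. (cmod (x i))\<^sup>2) has_sum S) UNIV \<Longrightarrow> x \<in> ell2"
  by (auto simp: ell2_def summable_on_def)

lemma has_sum_imp_ell2_norm:
  "((\<lambda>i. (cmod (x i))\<^sup>2) has_sum S) UNIV \<Longrightarrow> (ell2_norm x)\<^sup>2 = S"
  by (simp add: ell2_norm_power2 infsumI)

lemma ell2_zero: "(\<lambda>i. 0) \<in> ell2"
  by (simp add: ell2_def)

lemma ell2_scale: "x \<in> ell2 \<Longrightarrow> (\<lambda>i. c * x i) \<in> ell2"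
  by (simp add: ell2_def norm_mult power_mult_distrib summable_on_cmult_right)

lemma ell2_dominated:
  assumes "x \<in> ell2" "\<And>i. cmod (y i) \<le> cmod (x i)"
  shows "y \<in> ell2"
  unfolding ell2_def mem_Collect_eq
  by (rule summable_on_comparison_test[OF ell2_summable[OF assms(1)]])
    (use assms(2) in \<open>auto intro: power_mono\<close>)

lemma ell2_add:
  assumes "x \<in> ell2" "y \<in> ell2"
  shows "(\<lambda>i. x i + y i) \<in> ell2"
  unfolding ell2_def mem_Collect_eq
proof (rule summable_on_comparison_test)
  show "(\<lambda>i. 2 * (cmod (x i))\<^sup>2 + 2 * (cmod (y i))\<^sup>2) summable_on UNIV"
    by (intro summable_on_add summable_on_cmult_right ell2_summable assms)
  fix i
  have "(cmod (x i + y i))\<^sup>2 \<le> (cmod (x i) + cmod (y i))\<^sup>2"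
    by (intro power_mono norm_triangle_ineq) auto
  also have "\<dots> \<le> 2 * (cmod (x i))\<^sup>2 + 2 * (cmod (y i))\<^sup>2"
    using sum_squares_bound[of "cmod (x i)" "cmod (y i)"] by (simp add: power2_sum)
  finally show "(cmod (x i + y i))\<^sup>2 \<le> 2 * (cmod (x i))\<^sup>2 + 2 * (cmod (y i))\<^sup>2" .
qed auto

lemma ell2_sum:
  assumes "\<And>k. k \<in> F \<Longrightarrow> x k \<in> ell2"
  shows "(\<lambda>i. \<Sum>k\<in>F. x k i) \<in> ell2"
  using assms by (induction F rule: infinite_finite_induct) (auto simp: ell2_zero intro: ell2_add)

lemma ell2_finite_support:
  assumes "finite {i. x i \<noteq> 0}"
  shows "x \<in> ell2"
  unfolding ell2_def mem_Collect_eq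
  by (rule finite_nonzero_values_imp_summable_on) (use assms in simp)

lemma finite_sum_le_ell2_norm:
  assumes "x \<in> ell2" "finite F"
  shows "L2_set (\<lambda>i. cmod (x i)) F \<le> ell2_norm x"
  unfolding L2_set_def ell2_norm_def
  by (intro real_sqrt_le_mono finite_sum_le_infsum ell2_summable assms) auto

text \<open>Cauchy-Schwarz passes from finite sets to the limit: the terms are nonnegative, so one
  uniform bound on partial sums yields both summability and the estimate.\<close>

lemma ell2_mult_abs_summable:
  assumes "x \<in> ell2" "y \<in> ell2"
  shows "(\<lambda>i. cmod (x i) * cmod (y i)) summable_on UNIV"
    and "(\<Sum>\<^sub>\<infinity>i. cmod (x i) * cmod (y i)) \<le> ell2_norm x * ell2_norm y"
proof -
  have fin: "(\<Sum>i\<in>F. cmod (x i) * cmod (y i)) \<le> ell2_norm x * ell2_norm y" if "finite F" for F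
  proof -
    have "(\<Sum>i\<in>F. cmod (x i) * cmod (y i)) \<le> L2_set (\<lambda>i. cmod (x i)) F * L2_set (\<lambda>i. cmod (y i)) F"
      using L2_set_mult_ineq[of "\<lambda>i. cmod (x i)" "\<lambda>i. cmod (y i)" F] by simp
    also have "\<dots> \<le> ell2_norm x * ell2_norm y"
      by (intro mult_mono finite_sum_le_ell2_norm assms that) (auto simp: ell2_norm_nonneg)
    finally show ?thesis .
  qed
  show *: "(\<lambda>i. cmod (x i) * cmod (y i)) summable_on UNIV"
    by (rule nonneg_bdd_above_summable_on) (use fin in \<open>auto intro!: bdd_aboveI2\<close>)
  show "(\<Sum>\<^sub>\<infinity>i. cmod (x i) * cmod (y i)) \<le> ell2_norm x * ell2_norm y"
    by (rule infsum_le_finite_sums[OF *]) (use fin in auto)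
qed

lemma has_sum_cinner:
  assumes "x \<in> ell2" "y \<in> ell2"
  shows "((\<lambda>i. cnj (x i) * y i) has_sum cinner x y) UNIV"
  unfolding cinner_def
  by (rule has_sum_infsum, rule abs_summable_summable)
    (use ell2_mult_abs_summable(1)[OF assms] in \<open>simp add: norm_mult\<close>)

lemma has_sum_imp_cinner: "((\<lambda>i. cnj (x i) * y i) has_sum S) UNIV \<Longrightarrow> cinner x y = S"
  by (simp add: cinner_def infsumI)

lemma cmod_cinner_le:
  assumes "x \<in> ell2" "y \<in> ell2"
  shows "cmod (cinner x y) \<le> ell2_norm x * ell2_norm y"
proof -
  have "cmod (cinner x y) \<le> (\<Sum>\<^sub>\<infinity>i. cmod (x i) * cmod (y i))"
    by (rule norm_infsum_le[OF has_sum_cinner[OF assms] has_sum_infsum])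
      (use ell2_mult_abs_summable[OF assms] in \<open>auto simp: norm_mult\<close>)
  with ell2_mult_abs_summable(2)[OF assms] show ?thesis by linarith
qed

lemma cinner_commute: "cinner x y = cnj (cinner y x)"
  unfolding cinner_def infsum_cnj[symmetric] by (simp add: mult.commute)

lemma cinner_add_right:
  assumes "x \<in> ell2" "y \<in> ell2" "z \<in> ell2"
  shows "cinner x (\<lambda>i. y i + z i) = cinner x y + cinner x z"
  by (rule has_sum_imp_cinner)
    (use has_sum_add[OF has_sum_cinner[OF assms(1,2)] has_sum_cinner[OF assms(1,3)]]
      in \<open>simp add: algebra_simps\<close>)

lemma cinner_scale_right: "cinner x (\<lambda>i. c * y i) = c * cinner x y"
  unfolding cinner_def infsum_cmult_right'[symmetric] by (simp add: mult.left_commute)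

lemma cinner_sum_right:
  assumes "x \<in> ell2" "\<And>k. k \<in> F \<Longrightarrow> y k \<in> ell2"
  shows "cinner x (\<lambda>i. \<Sum>k\<in>F. y k i) = (\<Sum>k\<in>F. cinner x (y k))"
  using assms(2)
proof (induction F rule: infinite_finite_induct)
  case (insert k F)
  then show ?case using assms(1) by (simp add: cinner_add_right ell2_sum)
qed (auto simp: cinner_def)

lemma cinner_self:
  assumes "x \<in> ell2"
  shows "cinner x x = complex_of_real ((ell2_norm x)\<^sup>2)"
  by (rule has_sum_imp_cinner)
    (use has_sum_of_real[OF has_sum_ell2_norm[OF assms]]
      in \<open>simp add: mult.commute flip: complex_norm_square\<close>)

lemma ket_in_ell2: "ket i \<in> ell2"
  by (rule ell2_finite_support) (auto simp: ket_def)

lemma cinner_ket_left: "cinner (ket i) x = x i"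
  by (rule has_sum_imp_cinner, rule has_sum_finite_neutralI[where B = "{i}"]) (auto simp: ket_def)

lemma cinner_ket_right: "cinner x (ket i) = cnj (x i)"
  by (subst cinner_commute) (simp add: cinner_ket_left)

section \<open>Summation by slices at a fixed second coordinate\<close>

lemma slice_in_ell2:
  assumes "x \<in> ell2"
  shows "(\<lambda>\<alpha>. x (\<alpha>, y)) \<in> ell2"
proof -
  have "(\<lambda>i. (cmod (x i))\<^sup>2) summable_on range (\<lambda>\<alpha>. (\<alpha>, y))"
    using summable_on_subset[OF ell2_summable[OF assms]] by simp
  then show ?thesis
    unfolding ell2_def mem_Collect_eq by (subst (asm) summable_on_reindex) (auto simp: inj_on_def o_def)
qed

text \<open>Fubini with the ancilla index summed first, because orthonormality of \<open>chi\<close>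
  can be used only at a fixed photon number. \<open>has_sum_SigmaD\<close> sums the second
  coordinate first, hence the swap.\<close>

lemma has_sum_slices:
  fixes f :: "'i \<times> 'j \<Rightarrow> 'c :: {topological_comm_monoid_add,t3_space}"
  assumes "(f has_sum S) UNIV" "\<And>y. ((\<lambda>\<alpha>. f (\<alpha>, y)) has_sum g y) UNIV"
  shows "(g has_sum S) UNIV"
proof (rule has_sum_SigmaD)
  show "((\<lambda>(y, \<alpha>). f (\<alpha>, y)) has_sum S) (UNIV \<times> UNIV)"
    by (subst has_sum_swap) (use assms(1) in simp)
qed (use assms(2) in simp)

lemma cinner_slices:
  assumes "x \<in> ell2" "z \<in> ell2"
  shows "((\<lambda>y. cinner (\<lambda>\<alpha>. x (\<alpha>, y)) (\<lambda>\<alpha>. z (\<alpha>, y))) has_sum cinner x z) UNIV"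
  by (rule has_sum_slices[OF has_sum_cinner[OF assms]])
    (rule has_sum_cinner[OF slice_in_ell2[OF assms(1)] slice_in_ell2[OF assms(2)]])

text \<open>Tonelli, the converse direction: nonnegativity lets the iterated sum establish the joint
  one.\<close>

lemma ell2_of_slices:
  assumes "\<And>y. ((\<lambda>\<alpha>. (cmod (x (\<alpha>, y)))\<^sup>2) has_sum g y) UNIV" "(g has_sum S) UNIV"
  shows "((\<lambda>i. (cmod (x i))\<^sup>2) has_sum S) UNIV"
proof -
  have "(\<lambda>(y, \<alpha>). (cmod (x (\<alpha>, y)))\<^sup>2) summable_on UNIV \<times> UNIV"
    by (rule summable_on_SigmaI) (use assms in \<open>auto intro: has_sum_imp_summable\<close>)
  then have "((\<lambda>(y, \<alpha>). (cmod (x (\<alpha>, y)))\<^sup>2) has_sum S) (UNIV \<times> UNIV)"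
    by (intro has_sum_SigmaI) (use assms in auto)
  then show ?thesis
    by (subst (asm) has_sum_swap) (simp add: case_prod_unfold)
qed

lemma has_sum_finite_sum:
  fixes f :: "'k \<Rightarrow> 'i \<Rightarrow> 'b :: topological_comm_monoid_add"
  assumes "\<And>k. k \<in> F \<Longrightarrow> (f k has_sum S k) A"
  shows "((\<lambda>i. \<Sum>k\<in>F. f k i) has_sum (\<Sum>k\<in>F. S k)) A"
  using assms by (induction F rule: infinite_finite_induct) (auto intro: has_sum_add)


section \<open>Coefficients along the photon-number diagonals\<close>

lemma finite_atMost_fun: "finite {..y :: 'm::finite \<Rightarrow> nat}"
proof (rule finite_subset)
  show "{..y} \<subseteq> PiE UNIV (\<lambda>i. {..y i})"
    by (auto simp: le_fun_def)
qed (auto intro: finite_PiE)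

lemma le_add_fun: "n \<le> n + (a :: 'm \<Rightarrow> nat)"
  by (simp add: le_fun_def)

lemma add_diff_fun: "n \<le> y \<Longrightarrow> n + (y - n) = (y :: 'm \<Rightarrow> nat)"
  by (auto simp: le_fun_def fun_eq_iff)

lemma diff_le_fun: "y - n \<le> (y :: 'm \<Rightarrow> nat)"
  by (simp add: le_fun_def)

lemma add_diff_left_fun: "n + a - n = (a :: 'm \<Rightarrow> nat)"
  by (auto simp: fun_eq_iff)

lemma add_diff_right_fun: "a + n - n = (a :: 'm \<Rightarrow> nat)"
  by (auto simp: fun_eq_iff)

lemma diff_diff_fun: "n \<le> y \<Longrightarrow> y - (y - n) = (n :: 'm \<Rightarrow> nat)"
  by (auto simp: le_fun_def fun_eq_iff)

lemmas fun_arith = le_add_fun add_diff_fun diff_le_fun add_diff_left_fun add_diff_right_fun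
  diff_diff_fun

text \<open>Below a fixed y, subtraction from y is an involution; it exchanges the input number n
  with the number a of created pairs.\<close>

lemma sum_flip_atMost:
  fixes y :: "'m::finite \<Rightarrow> nat"
  shows "(\<Sum>a\<le>y. f a) = (\<Sum>n\<le>y. f (y - n))"
  by (rule sum.reindex_bij_witness[of _ "\<lambda>n. y - n" "\<lambda>n. y - n"]) (auto simp: fun_arith)

text \<open>The change of coordinates between (n, a) and (y, n) with y = n + a. Subtraction on
  naturals is truncated, so \<open>y - n\<close> inverts it only on the region n \<le> y.\<close>

lemma has_sum_diagonals_iff:
  fixes h :: "('m \<Rightarrow> nat) \<times> ('m \<Rightarrow> nat) \<Rightarrow> 'b :: {comm_monoid_add,topological_space}"
  shows "((\<lambda>(y, n). h (n, y - n)) has_sum S) (SIGMA y:UNIV. {..y}) \<longleftrightarrow> (h has_sum S) UNIV"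
  by (rule has_sum_reindex_bij_witness[of _ "\<lambda>(n, a). (n + a, n)" "\<lambda>(y, n). (n, y - n)"])
    (auto simp: fun_arith)

lemma has_sum_diagonalsD:
  fixes h :: "('m::finite \<Rightarrow> nat) \<times> ('m \<Rightarrow> nat) \<Rightarrow> 'b :: {topological_comm_monoid_add,t3_space}"
  assumes "(h has_sum S) UNIV"
  shows "((\<lambda>y. \<Sum>n\<le>y. h (n, y - n)) has_sum S) UNIV"
  by (rule has_sum_SigmaD[OF assms[folded has_sum_diagonals_iff]])
    (auto intro: has_sum_finiteI finite_atMost_fun)

section \<open>The isometry given by the ancilla basis, and its adjoint\<close>

locale ancilla_basis =
  fixes chi :: "('m::finite \<Rightarrow> nat) \<Rightarrow> 'a \<Rightarrow> complex"
  assumes orthonormal: "orthonormal_family chi"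
begin

lemma chi_in_ell2: "chi n \<in> ell2"
  using orthonormal by (simp add: orthonormal_family_def)

lemma cinner_chi: "cinner (chi n) (chi l) = of_bool (n = l)"
  using orthonormal by (simp add: orthonormal_family_def)

text \<open>
  The vectors \<open>chi n \<otimes> |n + a>\<close> are orthonormal; \<open>embed\<close> maps coefficients to vectors and
  \<open>coeff\<close> is its adjoint. All sums in \<open>embed\<close> are finite, so no convergence is involved there.
\<close>

definition embed :: "(('m \<Rightarrow> nat) \<times> ('m \<Rightarrow> nat) \<Rightarrow> complex) \<Rightarrow> 'a \<times> ('m \<Rightarrow> nat) \<Rightarrow> complex" where
  "embed g = (\<lambda>(\<alpha>, y). \<Sum>n\<le>y. g (n, y - n) * chi n \<alpha>)"

definition coeff :: "('a \<times> ('m \<Rightarrow> nat) \<Rightarrow> complex) \<Rightarrow> ('m \<Rightarrow> nat) \<times> ('m \<Rightarrow> nat) \<Rightarrow> complex" where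
  "coeff x = (\<lambda>(n, a). cinner (chi n) (\<lambda>\<alpha>. x (\<alpha>, n + a)))"

lemma embed_slice_in_ell2: "(\<lambda>\<alpha>. embed g (\<alpha>, y)) \<in> ell2"
  unfolding embed_def by (auto intro!: ell2_sum ell2_scale chi_in_ell2)

lemma cinner_embed_slice:
  assumes "u \<in> ell2"
  shows "cinner u (\<lambda>\<alpha>. embed g (\<alpha>, y)) = (\<Sum>n\<le>y. g (n, y - n) * cinner u (chi n))"
  unfolding embed_def case_prod_conv
  by (subst cinner_sum_right) (auto intro: assms ell2_scale chi_in_ell2 simp: cinner_scale_right)

lemma cinner_chi_embed_slice:
  "cinner (chi n) (\<lambda>\<alpha>. embed g (\<alpha>, y)) = (if n \<le> y then g (n, y - n) else 0)"
proof -
  have "(\<Sum>l\<le>y. g (l, y - l) * of_bool (n = l)) = (\<Sum>l\<le>y. if n = l then g (l, y - l) else 0)"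
    by (rule sum.cong) auto
  then show ?thesis
    by (simp add: cinner_embed_slice chi_in_ell2 cinner_chi finite_atMost_fun)
qed

lemma coeff_embed: "coeff (embed g) = g"
  by (auto simp: coeff_def cinner_chi_embed_slice fun_arith)

text \<open>Pythagoras within one row: at fixed y the vectors \<open>chi n\<close> with n \<le> y
  are orthonormal, so expanding the inner product of the slice with itself leaves only diagonal
  terms.\<close>

lemma embed_slice_norm:
  "((\<lambda>\<alpha>. (cmod (embed g (\<alpha>, y)))\<^sup>2) has_sum (\<Sum>n\<le>y. (cmod (g (n, y - n)))\<^sup>2)) UNIV"
proof -
  let ?s = "\<lambda>\<alpha>. embed g (\<alpha>, y)"
  have "complex_of_real ((ell2_norm ?s)\<^sup>2) = (\<Sum>n\<le>y. g (n, y - n) * cinner ?s (chi n))"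
    by (simp only: cinner_self[OF embed_slice_in_ell2, symmetric]
        cinner_embed_slice[OF embed_slice_in_ell2])
  also have "\<dots> = (\<Sum>n\<le>y. g (n, y - n) * cnj (g (n, y - n)))"
  proof (rule sum.cong)
    fix n assume "n \<in> {..y}"
    then show "g (n, y - n) * cinner ?s (chi n) = g (n, y - n) * cnj (g (n, y - n))"
      by (subst cinner_commute) (simp add: cinner_chi_embed_slice)
  qed simp
  also have "\<dots> = complex_of_real (\<Sum>n\<le>y. (cmod (g (n, y - n)))\<^sup>2)"
    by (simp add: complex_norm_square flip: of_real_power)
  finally have "(ell2_norm ?s)\<^sup>2 = (\<Sum>n\<le>y. (cmod (g (n, y - n)))\<^sup>2)"
    unfolding of_real_eq_iff .
  with has_sum_ell2_norm[OF embed_slice_in_ell2[of g y]] show ?thesis by simp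
qed

lemma has_sum_embed_norm:
  assumes "((\<lambda>k. (cmod (g k))\<^sup>2) has_sum S) UNIV"
  shows "((\<lambda>i. (cmod (embed g i))\<^sup>2) has_sum S) UNIV"
  by (rule ell2_of_slices[OF embed_slice_norm]) (rule has_sum_diagonalsD[OF assms])

lemma embed_in_ell2: "g \<in> ell2 \<Longrightarrow> embed g \<in> ell2"
  using has_sum_embed_norm[OF has_sum_ell2_norm] by (rule has_sum_imp_ell2)

lemma ell2_norm_embed: "g \<in> ell2 \<Longrightarrow> ell2_norm (embed g) = ell2_norm g"
  using has_sum_imp_ell2_norm[OF has_sum_embed_norm[OF has_sum_ell2_norm, of g]]
  by (simp add: ell2_norm_nonneg)

text \<open>Summing row by row avoids any assumption that \<open>coeff x\<close> is square-summable,
  so this is available for proving Bessel's inequality.\<close>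

lemma has_sum_cinner_embed:
  assumes "x \<in> ell2" "g \<in> ell2"
  shows "((\<lambda>y. \<Sum>n\<le>y. cnj (coeff x (n, y - n)) * g (n, y - n)) has_sum cinner x (embed g)) UNIV"
proof -
  have "cinner (\<lambda>\<alpha>. x (\<alpha>, y)) (\<lambda>\<alpha>. embed g (\<alpha>, y)) =
      (\<Sum>n\<le>y. cnj (coeff x (n, y - n)) * g (n, y - n))" for y
    unfolding cinner_embed_slice[OF slice_in_ell2[OF assms(1)]]
  proof (rule sum.cong)
    fix n assume "n \<in> {..y}"
    then show "g (n, y - n) * cinner (\<lambda>\<alpha>. x (\<alpha>, y)) (chi n) = cnj (coeff x (n, y - n)) * g (n, y - n)"
      by (subst cinner_commute) (simp add: coeff_def fun_arith)
  qed simp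
  with cinner_slices[OF assms(1) embed_in_ell2[OF assms(2)]] show ?thesis by simp
qed

text \<open>Test x against \<open>embed g\<close>, where g truncates \<open>coeff x\<close> to a
  finite set F. With S the partial sum of squares, the inner product is S and the norm of
  \<open>embed g\<close> is sqrt S, so Cauchy-Schwarz gives S \<le> \<open>ell2_norm x\<close> *
  sqrt S; dividing by sqrt S bounds all partial sums.\<close>

lemma bessel:
  assumes x: "x \<in> ell2"
  shows "coeff x \<in> ell2"
proof -
  have "(\<Sum>k\<in>F. (cmod (coeff x k))\<^sup>2) \<le> (ell2_norm x)\<^sup>2" if F: "finite F" for F
  proof -
    define g where "g k = (if k \<in> F then coeff x k else 0)" for k
    define S where "S = (\<Sum>k\<in>F. (cmod (coeff x k))\<^sup>2)"
    have "S \<ge> 0" by (auto simp: S_def intro: sum_nonneg)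
    have hsg: "((\<lambda>k. (cmod (g k))\<^sup>2) has_sum S) UNIV"
      by (rule has_sum_finite_neutralI[of F]) (use F in \<open>auto simp: g_def S_def\<close>)
    then have g: "g \<in> ell2" and gS: "ell2_norm g = sqrt S"
      by (auto intro: has_sum_imp_ell2 simp: ell2_norm_def infsumI)
    have "((\<lambda>k. cnj (coeff x k) * g k) has_sum complex_of_real S) UNIV"
      by (rule has_sum_finite_neutralI[of F])
        (use F in \<open>auto simp: g_def S_def complex_norm_square mult.commute simp flip: of_real_power\<close>)
    from has_sum_diagonalsD[OF this] have "cinner x (embed g) = complex_of_real S"
      using has_sum_cinner_embed[OF x g] by (auto intro: has_sum_unique)
    with cmod_cinner_le[OF x embed_in_ell2[OF g]] have "S \<le> ell2_norm x * sqrt S"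
      using \<open>S \<ge> 0\<close> by (simp add: ell2_norm_embed[OF g] gS)
    then have "sqrt S * sqrt S \<le> ell2_norm x * sqrt S"
      using \<open>S \<ge> 0\<close> by simp
    then have "sqrt S \<le> ell2_norm x"
      using \<open>S \<ge> 0\<close> ell2_norm_nonneg[of x]
      by (cases "S = 0") (auto simp del: real_sqrt_mult_self simp: mult_le_cancel_right)
    then have "S \<le> (ell2_norm x)\<^sup>2"
      by (rule sqrt_le_D)
    then show ?thesis by (simp add: S_def)
  qed
  then show ?thesis
    unfolding ell2_def mem_Collect_eq
    by (intro nonneg_bdd_above_summable_on bdd_aboveI2) auto
qed

lemma cinner_embed_right:
  assumes "x \<in> ell2" "g \<in> ell2"
  shows "cinner x (embed g) = cinner (coeff x) g"
  using has_sum_cinner_embed[OF assms] has_sum_diagonalsD[OF has_sum_cinner[OF bessel[OF assms(1)] assms(2)]]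
  by (rule has_sum_unique)

lemma cinner_embed_left:
  assumes "x \<in> ell2" "g \<in> ell2"
  shows "cinner (embed g) x = cinner g (coeff x)"
  using cinner_embed_right[OF assms] by (metis cinner_commute)

lemma coeff_add:
  assumes "x \<in> ell2" "z \<in> ell2"
  shows "coeff (\<lambda>i. x i + z i) = (\<lambda>k. coeff x k + coeff z k)"
  by (auto simp: coeff_def fun_eq_iff chi_in_ell2 slice_in_ell2 assms intro!: cinner_add_right)

lemma coeff_scale: "coeff (\<lambda>i. c * x i) = (\<lambda>k. c * coeff x k)"
  by (auto simp: coeff_def cinner_scale_right)

lemma embed_add: "embed (\<lambda>k. g k + h k) = (\<lambda>i. embed g i + embed h i)"
  by (auto simp: embed_def sum.distrib distrib_right)

lemma embed_scale: "embed (\<lambda>k. c * g k) = (\<lambda>i. c * embed g i)"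
  by (auto simp: embed_def sum_distrib_left mult.assoc)

text \<open>Supplies density of multiplier domains: a vector with finitely many nonzero rows y has
  finitely many nonzero coefficients, since n + a = y has finitely many solutions.\<close>

lemma finite_rows_dense:
  assumes x: "x \<in> ell2" and "\<epsilon> > 0"
  obtains z F where "finite F" "z \<in> ell2" "\<And>\<alpha> y. y \<notin> F \<Longrightarrow> z (\<alpha>, y) = 0"
    "ell2_norm (\<lambda>i. x i - z i) < \<epsilon>"
proof -
  \<comment> \<open>The approximation is non-strict; aiming at half of the squared error makes the
    final bound strict.\<close>
  obtain F where F: "finite F"
    and d: "dist (\<Sum>i\<in>F. (cmod (x i))\<^sup>2) (\<Sum>\<^sub>\<infinity>i. (cmod (x i))\<^sup>2) \<le> \<epsilon>\<^sup>2 / 2"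
    using infsum_finite_approximation[OF ell2_summable[OF x], of "\<epsilon>\<^sup>2 / 2"] \<open>\<epsilon> > 0\<close> by auto
  \<comment> \<open>Every row that meets F is kept whole. This removes at most the entries outside
    F, so the tail of x over the complement of F bounds the error.\<close>
  define z where "z i = (if snd i \<in> snd ` F then x i else 0)" for i
  have z: "z \<in> ell2"
    by (rule ell2_dominated[OF x]) (simp add: z_def)
  have sub: "(\<lambda>i. (cmod (x i))\<^sup>2) summable_on - F"
    using summable_on_subset[OF ell2_summable[OF x]] by simp
  have split: "(\<Sum>\<^sub>\<infinity>i. (cmod (x i))\<^sup>2) = (\<Sum>i\<in>F. (cmod (x i))\<^sup>2) + (\<Sum>\<^sub>\<infinity>i\<in>-F. (cmod (x i))\<^sup>2)"
    using infsum_Un_disjoint[OF summable_on_finite[OF F] sub] F by simp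
  have "(\<Sum>\<^sub>\<infinity>i. (cmod (x i - z i))\<^sup>2) \<le> (\<Sum>\<^sub>\<infinity>i\<in>-F. (cmod (x i))\<^sup>2)"
  proof (rule infsum_mono_neutral[OF _ sub])
    have "(\<lambda>i. x i - z i) \<in> ell2"
      by (rule ell2_dominated[OF x]) (simp add: z_def)
    then show "(\<lambda>i. (cmod (x i - z i))\<^sup>2) summable_on UNIV" by (rule ell2_summable)
  qed (auto simp: z_def image_iff)
  also have "\<dots> \<le> \<epsilon>\<^sup>2 / 2"
    using d split by (simp add: dist_real_def)
  also have "\<dots> < \<epsilon>\<^sup>2" using \<open>\<epsilon> > 0\<close> by simp
  finally have "ell2_norm (\<lambda>i. x i - z i) < \<epsilon>"
    unfolding ell2_norm_def using \<open>\<epsilon> > 0\<close> by (simp add: real_sqrt_less_iff real_less_lsqrt)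
  moreover have "z (\<alpha>, y) = 0" if "y \<notin> snd ` F" for \<alpha> y
    using that by (simp only: z_def snd_conv if_False)
  ultimately show thesis
    using that[OF finite_imageI[OF F] z] by blast
qed

text \<open>No bound on \<open>\<mu>\<close> is assumed, so the domain is the maximal one. The
  operator vanishes on vectors orthogonal to the range of \<open>embed\<close>. Symmetry holds
  because \<open>\<mu>\<close> is real and moves across the inner product of coefficients.\<close>

lemma symmetric_operator_multiplier:
  fixes \<mu> :: "('m \<Rightarrow> nat) \<times> ('m \<Rightarrow> nat) \<Rightarrow> real"
  shows "symmetric_operator {x \<in> ell2. (\<lambda>k. \<mu> k * coeff x k) \<in> ell2}
    (\<lambda>x. embed (\<lambda>k. \<mu> k * coeff x k))" (is "symmetric_operator ?D ?L")
  unfolding symmetric_operator_def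
proof (intro conjI ballI allI impI)
  show "?D \<subseteq> ell2" by auto
  show "(\<lambda>i. 0) \<in> ?D"
    using coeff_scale[of 0 "\<lambda>_. 0"] by (simp add: ell2_zero)
next
  fix x z assume x: "x \<in> ?D" and z: "z \<in> ?D"
  then have *: "(\<lambda>k. \<mu> k * coeff (\<lambda>i. x i + z i) k) = (\<lambda>k. \<mu> k * coeff x k + \<mu> k * coeff z k)"
    by (simp add: coeff_add distrib_left)
  show "(\<lambda>i. x i + z i) \<in> ?D"
    using x z unfolding mem_Collect_eq * by (simp add: ell2_add)
  show "?L (\<lambda>i. x i + z i) = (\<lambda>i. ?L x i + ?L z i)"
    by (rule trans[OF arg_cong[OF *, of embed] embed_add])
next
  fix c x assume x: "x \<in> ?D"
  have *: "(\<lambda>k. \<mu> k * coeff (\<lambda>i. c * x i) k) = (\<lambda>k. c * (\<mu> k * coeff x k))"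
    by (simp add: coeff_scale mult.left_commute)
  show "(\<lambda>i. c * x i) \<in> ?D"
    using x unfolding mem_Collect_eq * by (simp add: ell2_scale)
  show "?L (\<lambda>i. c * x i) = (\<lambda>i. c * ?L x i)"
    by (rule trans[OF arg_cong[OF *, of embed] embed_scale])
next
  fix x :: "'a \<times> ('m \<Rightarrow> nat) \<Rightarrow> complex" and \<epsilon> :: real
  assume "x \<in> ell2" "0 < \<epsilon>"
  then obtain z F where z: "finite F" "z \<in> ell2" "\<And>\<alpha> y. y \<notin> F \<Longrightarrow> z (\<alpha>, y) = 0"
    "ell2_norm (\<lambda>i. x i - z i) < \<epsilon>"
    by (rule finite_rows_dense) (rule that)
  have "{k. complex_of_real (\<mu> k) * coeff z k \<noteq> 0} \<subseteq> (\<lambda>(y, n). (n, y - n)) ` (SIGMA y:F. {..y})"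
  proof
    fix k assume "k \<in> {k. complex_of_real (\<mu> k) * coeff z k \<noteq> 0}"
    then obtain n a where k: "k = (n, a)" "coeff z (n, a) \<noteq> 0"
      by (cases k) auto
    then have "n + a \<in> F"
      using z(3)[of "n + a"] by (cases "n + a \<in> F") (auto simp: coeff_def cinner_def)
    then show "k \<in> (\<lambda>(y, n). (n, y - n)) ` (SIGMA y:F. {..y})"
      by (intro image_eqI[of _ _ "(n + a, n)"]) (auto simp: fun_arith k)
  qed
  then have "finite {k. complex_of_real (\<mu> k) * coeff z k \<noteq> 0}"
    by (rule finite_subset) (intro finite_imageI finite_SigmaI z(1) finite_atMost_fun)
  then have "z \<in> ?D"
    using z(2) by (simp add: ell2_finite_support)
  with z(4) show "\<exists>y\<in>?D. ell2_norm (\<lambda>i. x i - y i) < \<epsilon>" by blast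
next
  fix x assume "x \<in> ?D"
  then show "?L x \<in> ell2" by (auto intro: embed_in_ell2)
next
  fix x z assume x: "x \<in> ?D" and z: "z \<in> ?D"
  have "cinner x (?L z) = cinner (coeff x) (\<lambda>k. \<mu> k * coeff z k)"
    using x z by (simp add: cinner_embed_right)
  also have "\<dots> = cinner (\<lambda>k. \<mu> k * coeff x k) (coeff z)"
    by (simp add: cinner_def mult_ac)
  also have "\<dots> = cinner (?L x) z"
    using x z by (simp add: cinner_embed_left)
  finally show "cinner x (?L z) = cinner (?L x) z" .
qed

end


section \<open>Mixtures of orthogonal branches\<close>

text \<open>Only the derivative looks beyond \<tau>, and it depends on the family near \<tau> alone.
  This allows the output state to be replaced by a formula that is established for nonnegative
  parameters.\<close>

lemma has_quantum_fisher_information_cong: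
  assumes "has_quantum_fisher_information \<sigma> \<tau> K" "\<forall>\<^sub>F t in nhds \<tau>. \<rho> t = \<sigma> t"
  shows "has_quantum_fisher_information \<rho> \<tau> K"
proof -
  have eq: "\<rho> \<tau> = \<sigma> \<tau>"
    using assms(2) by (rule eventually_nhds_x_imp_x)
  have "((\<lambda>t. \<rho> t i j) has_vector_derivative d) (at \<tau>)"
    if "((\<lambda>t. \<sigma> t i j) has_vector_derivative d) (at \<tau>)" for i j d
  proof -
    have "\<forall>\<^sub>F t in nhds \<tau>. \<rho> t i j = \<sigma> t i j"
      using assms(2) by eventually_elim simp
    then show ?thesis
      using that by (subst has_vector_derivative_cong_ev[where g = "\<lambda>t. \<sigma> t i j"]) (auto simp: eq)
  qed
  then show ?thesis
    using assms(1) unfolding has_quantum_fisher_information_def is_sld_def Let_def eq by blast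
qed

context ancilla_basis
begin

text \<open>The unnormalized vector left when the environment is found with a photons; for the
  amplified probe its squared norm is the probability of a.\<close>

definition branch :: "(('m \<Rightarrow> nat) \<times> ('m \<Rightarrow> nat) \<Rightarrow> real) \<Rightarrow> ('m \<Rightarrow> nat) \<Rightarrow> 'a \<times> ('m \<Rightarrow> nat) \<Rightarrow> complex" where
  "branch q a = embed (\<lambda>(n, b). if b = a then complex_of_real (q (n, a)) else 0)"

text \<open>Formally the sum over all a of w a |b_a><b_a|: branches with a not below
  \<open>snd i\<close> vanish at i, so the bound only makes the sum finite. The weights w serve to
  write the state (w = 1) and its square root in one form.\<close>

definition mixture ::
  "(('m \<Rightarrow> nat) \<times> ('m \<Rightarrow> nat) \<Rightarrow> real) \<Rightarrow> (('m \<Rightarrow> nat) \<Rightarrow> real) \<Rightarrow>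
   ('a \<times> ('m \<Rightarrow> nat), 'a \<times> ('m \<Rightarrow> nat)) cmat" where
  "mixture q w = (\<lambda>i j. \<Sum>a\<le>snd i. complex_of_real (w a) * branch q a i * cnj (branch q a j))"

lemma branch_apply:
  "branch q a (\<alpha>, y) = (if a \<le> y then complex_of_real (q (y - a, a)) * chi (y - a) \<alpha> else 0)"
proof -
  have "branch q a (\<alpha>, y) =
      (\<Sum>n\<le>y. (if n = a then complex_of_real (q (y - n, a)) else 0) * chi (y - n) \<alpha>)"
    unfolding branch_def embed_def case_prod_conv
    by (subst sum_flip_atMost) (auto intro!: sum.cong simp: fun_arith)
  also have "\<dots> = (\<Sum>n\<le>y. if n = a then complex_of_real (q (y - a, a)) * chi (y - a) \<alpha> else 0)"
    by (rule sum.cong) auto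
  finally show ?thesis by (simp add: finite_atMost_fun)
qed

text \<open>Different branches occupy disjoint sets of coefficients (n, a), so a superposition of
  them multiplies \<open>q (n, a)\<close> by a factor depending on a alone.\<close>

lemma sum_branch:
  "(\<Sum>a\<le>snd i. branch q a i * c a) = embed (\<lambda>(n, a). complex_of_real (q (n, a)) * c a) i"
proof (cases i)
  case (Pair \<alpha> y)
  have "(\<Sum>a\<le>y. branch q a (\<alpha>, y) * c a) = (\<Sum>n\<le>y. branch q (y - n) (\<alpha>, y) * c (y - n))"
    by (rule sum_flip_atMost)
  then show ?thesis
    unfolding Pair embed_def by (auto simp: branch_apply fun_arith mult_ac intro!: sum.cong)
qed

lemma mixture_column:
  "mixture q w i j = embed (\<lambda>(n, a). complex_of_real (q (n, a)) * (w a * cnj (branch q a j))) i"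
  unfolding sum_branch[where q = q and c = "\<lambda>a. w a * cnj (branch q a j)", symmetric] mixture_def
  by (rule sum.cong) simp_all

text \<open>Both sums reduce to the a below both photon numbers, as one of the two factors is zero
  elsewhere. It repairs the asymmetry in i and j of the summation range when adjoints are
  taken.\<close>

lemma sum_branch_outside:
  assumes "\<And>a. branch q a j = 0 \<Longrightarrow> c a = 0"
  shows "(\<Sum>a\<le>snd j. branch r a i * c a) = (\<Sum>a\<le>snd i. branch r a i * c a)"
proof -
  obtain \<alpha> y \<beta> z where ij: "i = (\<alpha>, y)" "j = (\<beta>, z)" by (cases i; cases j)
  have c: "c a = 0" if "\<not> a \<le> z" for a
    using that by (intro assms) (simp add: ij branch_apply)
  have "(\<Sum>a\<le>z. branch r a i * c a) = (\<Sum>a\<in>{..y} \<inter> {..z}. branch r a i * c a)"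
    by (rule sum.mono_neutral_right) (auto simp: ij branch_apply finite_atMost_fun)
  also have "\<dots> = (\<Sum>a\<le>y. branch r a i * c a)"
    by (rule sum.mono_neutral_left) (auto simp: finite_atMost_fun c)
  finally show ?thesis by (simp add: ij)
qed

lemma has_vector_derivative_branch:
  assumes "\<And>k. ((\<lambda>t. q t k) has_field_derivative q' k) (at \<tau>)"
  shows "((\<lambda>t. branch (q t) a i) has_vector_derivative branch q' a i) (at \<tau>)"
proof (cases i)
  case (Pair \<alpha> y)
  have "((\<lambda>t. complex_of_real (q t k)) has_vector_derivative complex_of_real (q' k)) (at \<tau>)" for k
    using assms[of k]
    by (intro has_vector_derivative_of_real) (simp add: has_real_derivative_iff_has_vector_derivative)
  then show ?thesis
    unfolding Pair branch_apply by (cases "a \<le> y") (auto intro!: has_vector_derivative_mult_left)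
qed

text \<open>Each entry is a finite sum over a range independent of t, so the product rule applies
  term by term without exchanging limits.\<close>

lemma has_vector_derivative_mixture:
  assumes "\<And>k. ((\<lambda>t. q t k) has_field_derivative q' k) (at \<tau>)"
  shows "((\<lambda>t. mixture (q t) (\<lambda>_. 1) i j) has_vector_derivative
    (\<Sum>a\<le>snd i. branch q' a i * cnj (branch (q \<tau>) a j)) +
    (\<Sum>a\<le>snd i. branch (q \<tau>) a i * cnj (branch q' a j))) (at \<tau>)"
proof -
  have "((\<lambda>t. \<Sum>a\<le>snd i. branch (q t) a i * cnj (branch (q t) a j)) has_vector_derivative
    (\<Sum>a\<le>snd i. branch (q \<tau>) a i * cnj (branch q' a j) + branch q' a i * cnj (branch (q \<tau>) a j)))
    (at \<tau>)"
    by (intro has_vector_derivative_sum has_vector_derivative_mult has_vector_derivative_cnj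
        has_vector_derivative_branch assms)
  then show ?thesis
    by (simp add: mixture_def sum.distrib add.commute)
qed

end

section \<open>Mixtures as operators: boundedness, positivity, products and square root\<close>

locale branches = ancilla_basis chi
  for chi :: "('m::finite \<Rightarrow> nat) \<Rightarrow> 'a \<Rightarrow> complex" +
  fixes q :: "('m \<Rightarrow> nat) \<times> ('m \<Rightarrow> nat) \<Rightarrow> real"
  assumes normalized: "((\<lambda>k. (q k)\<^sup>2) has_sum 1) UNIV"
begin

definition weight :: "('m \<Rightarrow> nat) \<Rightarrow> real" where
  "weight a = ell2_norm (branch q a)"

lemma q_has_norm: "((\<lambda>k. (cmod (complex_of_real (q k)))\<^sup>2) has_sum 1) UNIV"
  using normalized by simp

lemma q_ell2: "(\<lambda>k. complex_of_real (q k)) \<in> ell2"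
  by (rule has_sum_imp_ell2[OF q_has_norm])

lemma branch_coeff_ell2: "(\<lambda>(n, b). if b = a then complex_of_real (q (n, a)) else 0) \<in> ell2"
  by (rule ell2_dominated[OF q_ell2]) auto

lemma branch_in_ell2: "branch q a \<in> ell2"
  unfolding branch_def by (rule embed_in_ell2[OF branch_coeff_ell2])

lemma coeff_branch: "coeff (branch q a) = (\<lambda>(n, b). if b = a then complex_of_real (q (n, a)) else 0)"
  by (simp add: branch_def coeff_embed)

lemma weight_nonneg: "0 \<le> weight a"
  by (simp add: weight_def ell2_norm_nonneg)

lemma weight_le_1: "weight a \<le> 1"
proof -
  have "(weight a)\<^sup>2 \<le> 1"
    unfolding weight_def branch_def ell2_norm_embed[OF branch_coeff_ell2]
    by (rule has_sum_mono[OF has_sum_ell2_norm[OF branch_coeff_ell2] q_has_norm]) auto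
  then show ?thesis by (simp add: power_le_one_iff weight_nonneg power2_le_iff_abs_le abs_square_le_1)
qed

lemma abs_q_le_weight: "\<bar>q (n, a)\<bar> \<le> weight a"
  using finite_sum_le_ell2_norm[OF branch_coeff_ell2, of "{(n, a)}" a]
  by (simp add: weight_def branch_def ell2_norm_embed[OF branch_coeff_ell2])

lemma cmod_branch_le_weight: "cmod (branch q a i) \<le> weight a"
  using finite_sum_le_ell2_norm[OF branch_in_ell2, of "{i}" a] by (simp add: weight_def)

lemma cmod_cinner_branch_le: "x \<in> ell2 \<Longrightarrow> cmod (cinner (branch q a) x) \<le> weight a * ell2_norm x"
  unfolding weight_def by (rule cmod_cinner_le[OF branch_in_ell2])

text \<open>Images under mixtures have coefficients of this shape; since q has norm 1, a uniform
  bound on c bounds the norm of the result.\<close>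

lemma q_mult_ell2:
  fixes c :: "('m \<Rightarrow> nat) \<Rightarrow> complex"
  assumes "\<And>a. cmod (c a) \<le> B"
  shows "(\<lambda>(n, a). complex_of_real (q (n, a)) * c a) \<in> ell2"
    and "ell2_norm (\<lambda>(n, a). complex_of_real (q (n, a)) * c a) \<le> B"
proof -
  have B: "0 \<le> B" using assms[of undefined] norm_ge_zero order_trans by blast
  have le: "cmod (case k of (n, a) \<Rightarrow> complex_of_real (q (n, a)) * c a) \<le> B * \<bar>q k\<bar>" for k
    using assms[of "snd k"] B by (cases k) (auto simp: norm_mult mult.commute intro: mult_right_mono)
  have Bq: "((\<lambda>k. (B * \<bar>q k\<bar>)\<^sup>2) has_sum B\<^sup>2) UNIV"
    using has_sum_cmult_right[OF normalized, of "B\<^sup>2"] by (simp add: power_mult_distrib)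
  show *: "(\<lambda>(n, a). complex_of_real (q (n, a)) * c a) \<in> ell2"
    by (rule ell2_dominated[OF ell2_scale[OF q_ell2, of B]])
      (use le B in \<open>auto simp: norm_mult\<close>)
  have "(ell2_norm (\<lambda>(n, a). complex_of_real (q (n, a)) * c a))\<^sup>2 \<le> B\<^sup>2"
    by (rule has_sum_mono[OF has_sum_ell2_norm[OF *] Bq]) (intro power_mono le norm_ge_zero)
  then show "ell2_norm (\<lambda>(n, a). complex_of_real (q (n, a)) * c a) \<le> B"
    using B by (rule power2_le_imp_le)
qed

lemma has_sum_mixture:
  assumes "x \<in> ell2"
  shows "((\<lambda>j. mixture q w i j * x j) has_sum
    embed (\<lambda>(n, a). complex_of_real (q (n, a)) * (w a * cinner (branch q a) x)) i) UNIV"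
proof -
  have "((\<lambda>j. \<Sum>a\<le>snd i. branch q a i * w a * (cnj (branch q a j) * x j)) has_sum
      (\<Sum>a\<le>snd i. branch q a i * w a * cinner (branch q a) x)) UNIV"
    by (intro has_sum_finite_sum has_sum_cmult_right has_sum_cinner branch_in_ell2 assms)
  moreover have "(\<lambda>j. \<Sum>a\<le>snd i. branch q a i * w a * (cnj (branch q a j) * x j)) =
      (\<lambda>j. mixture q w i j * x j)"
    unfolding mixture_def sum_distrib_right by (intro ext sum.cong) simp_all
  ultimately show ?thesis
    unfolding sum_branch[where q = q and c = "\<lambda>a. w a * cinner (branch q a) x", symmetric]
    by (simp only: mult.assoc)
qed

lemma mixture_app:
  assumes "x \<in> ell2"
  shows "mat_app (mixture q w) x =
    embed (\<lambda>(n, a). complex_of_real (q (n, a)) * (w a * cinner (branch q a) x))"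
  unfolding mat_app_def using has_sum_mixture[OF assms] by (blast intro: infsumI)

text \<open>The branches are orthogonal since \<open>a\<close> can be read off the index \<open>(n, n + a)\<close>.\<close>

lemma cinner_branch_embed:
  fixes c :: "('m \<Rightarrow> nat) \<Rightarrow> complex"
  assumes "\<And>a. cmod (c a) \<le> B"
  shows "cinner (branch q a) (embed (\<lambda>(n, a). complex_of_real (q (n, a)) * c a)) = (weight a)\<^sup>2 * c a"
proof -
  have "cinner (branch q a) (embed (\<lambda>(n, a). complex_of_real (q (n, a)) * c a)) =
      cinner (coeff (branch q a)) (\<lambda>(n, a). complex_of_real (q (n, a)) * c a)"
    by (rule cinner_embed_right[OF branch_in_ell2 q_mult_ell2(1)[OF assms]])
  also have "\<dots> = cinner (coeff (branch q a)) (\<lambda>k. c a * coeff (branch q a) k)"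
    unfolding cinner_def coeff_branch by (rule infsum_cong) auto
  also have "\<dots> = c a * cinner (branch q a) (branch q a)"
    unfolding cinner_scale_right
    by (simp add: coeff_branch cinner_embed_right[OF branch_in_ell2 branch_coeff_ell2, folded branch_def])
  finally show ?thesis
    by (simp add: cinner_self[OF branch_in_ell2] weight_def)
qed

context
  fixes w :: "('m \<Rightarrow> nat) \<Rightarrow> real"
  assumes w_nonneg: "\<And>a. 0 \<le> w a" and w_weight: "\<And>a. w a * weight a \<le> 1"
begin

text \<open>An overlap with branch a carries a factor \<open>weight a\<close>, which absorbs w even
  when w is unbounded. The assumption on w covers both w = 1, by \<open>weight_le_1\<close>, and w =
  1 / \<open>weight\<close>.\<close>

lemma weighted_bound:
  assumes "cmod c \<le> weight a * C" "0 \<le> C"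
  shows "cmod (complex_of_real (w a) * c) \<le> C"
proof -
  have "cmod (complex_of_real (w a) * c) \<le> w a * (weight a * C)"
    using assms w_nonneg by (simp add: norm_mult mult_left_mono)
  also have "\<dots> \<le> C"
    using mult_right_mono[OF w_weight assms(2), of a] by (simp add: mult_ac)
  finally show ?thesis .
qed

lemma weighted_cinner_bound:
  "x \<in> ell2 \<Longrightarrow> cmod (complex_of_real (w a) * cinner (branch q a) x) \<le> ell2_norm x"
  by (intro weighted_bound cmod_cinner_branch_le ell2_norm_nonneg)

lemma weighted_branch_bound: "cmod (complex_of_real (w a) * cnj (branch q a i)) \<le> 1"
  by (rule weighted_bound) (auto simp: cmod_branch_le_weight)

lemma bounded_mixture: "bounded_op (mixture q w)"
  unfolding bounded_op_def
proof (intro exI[of _ 1] ballI conjI allI)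
  fix x :: "'a \<times> ('m \<Rightarrow> nat) \<Rightarrow> complex" assume x: "x \<in> ell2"
  show "(\<lambda>j. mixture q w i j * x j) summable_on UNIV" for i
    using has_sum_mixture[OF x] by (rule has_sum_imp_summable)
  note g = q_mult_ell2[OF weighted_cinner_bound[OF x]]
  show "mat_app (mixture q w) x \<in> ell2"
    unfolding mixture_app[OF x] by (rule embed_in_ell2[OF g(1)])
  show "ell2_norm (mat_app (mixture q w) x) \<le> 1 * ell2_norm x"
    unfolding mixture_app[OF x] ell2_norm_embed[OF g(1)] using g(2) by simp
qed

text \<open>The quadratic form is the sum over a of w a times the squared modulus of the overlap of
  x with branch a.\<close>

lemma positive_mixture:
  assumes x: "x \<in> ell2"
  shows "cinner x (mat_app (mixture q w) x) \<in> \<real>\<^sub>\<ge>\<^sub>0"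
proof -
  let ?u = "\<lambda>a. cinner (branch q a) x"
  let ?g = "\<lambda>(n, a). complex_of_real (q (n, a)) * (w a * ?u a)"
  \<comment> \<open>The overlap is computed slice by slice in the pair number; only the slice at a
    contributes.\<close>
  have u: "?u a = cinner (\<lambda>n. complex_of_real (q (n, a))) (\<lambda>n. coeff x (n, a))" for a
  proof -
    have "((\<lambda>b. cinner (\<lambda>n. coeff (branch q a) (n, b)) (\<lambda>n. coeff x (n, b))) has_sum
        cinner (\<lambda>(n, b). if b = a then complex_of_real (q (n, a)) else 0) (coeff x)) UNIV"
      unfolding coeff_branch by (rule cinner_slices[OF branch_coeff_ell2 bessel[OF x]])
    moreover have "((\<lambda>b. cinner (\<lambda>n. coeff (branch q a) (n, b)) (\<lambda>n. coeff x (n, b))) has_sum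
        cinner (\<lambda>n. complex_of_real (q (n, a))) (\<lambda>n. coeff x (n, a))) UNIV"
      by (rule has_sum_finite_neutralI[of "{a}"]) (auto simp: coeff_branch cinner_def)
    ultimately show ?thesis
      unfolding branch_def cinner_embed_left[OF x branch_coeff_ell2] by (rule has_sum_unique)
  qed
  have "((\<lambda>a. cinner (\<lambda>n. coeff x (n, a)) (\<lambda>n. ?g (n, a))) has_sum cinner (coeff x) ?g) UNIV"
    by (rule cinner_slices[OF bessel[OF x] q_mult_ell2(1)[OF weighted_cinner_bound[OF x]]])
  moreover have "cinner (\<lambda>n. coeff x (n, a)) (\<lambda>n. ?g (n, a)) =
      complex_of_real (w a * (cmod (?u a))\<^sup>2)" for a
  proof -
    have "(\<lambda>n. ?g (n, a)) = (\<lambda>n. (w a * ?u a) * complex_of_real (q (n, a)))"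
      by (simp only: case_prod_conv mult.commute)
    then have "cinner (\<lambda>n. coeff x (n, a)) (\<lambda>n. ?g (n, a)) =
        w a * ?u a * cinner (\<lambda>n. coeff x (n, a)) (\<lambda>n. complex_of_real (q (n, a)))"
      by (simp only: cinner_scale_right)
    also have "cinner (\<lambda>n. coeff x (n, a)) (\<lambda>n. complex_of_real (q (n, a))) = cnj (?u a)"
      unfolding u by (rule cinner_commute)
    finally show ?thesis by (simp add: complex_norm_square mult.assoc del: of_real_power)
  qed
  ultimately have *: "((\<lambda>a. complex_of_real (w a * (cmod (?u a))\<^sup>2)) has_sum
      cinner x (mat_app (mixture q w) x)) UNIV"
    unfolding mixture_app[OF x]
      cinner_embed_right[OF x q_mult_ell2(1)[OF weighted_cinner_bound[OF x]]] by simp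
  have "0 \<le> Re (cinner x (mat_app (mixture q w) x))"
    using has_sum_Re[OF *] by (rule has_sum_nonneg) (simp add: w_nonneg)
  moreover have "Im (cinner x (mat_app (mixture q w) x)) = 0"
    using has_sum_Im[OF *] by (simp add: has_sum_iff)
  ultimately show ?thesis
    by (simp add: complex_nonneg_Reals_iff)
qed

end

text \<open>Orthogonality removes the products of distinct branches; equal ones contribute their
  squared norm.\<close>

lemma mixture_mult:
  assumes "\<And>a. 0 \<le> v a" "\<And>a. v a * weight a \<le> 1"
  shows "mat_mult (mixture q w) (mixture q v) = mixture q (\<lambda>a. w a * ((weight a)\<^sup>2 * v a))"
proof (intro ext)
  fix i k
  note b = weighted_branch_bound[OF assms, where i = k]
  have col: "(\<lambda>j. mixture q v j k) = embed (\<lambda>(n, a). complex_of_real (q (n, a)) * (v a * cnj (branch q a k)))"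
    by (rule ext) (rule mixture_column)
  have "mat_mult (mixture q w) (mixture q v) i k = mat_app (mixture q w) (\<lambda>j. mixture q v j k) i"
    by (simp add: mat_mult_def mat_app_def)
  also have "\<dots> = embed (\<lambda>(n, a). complex_of_real (q (n, a)) *
      (w a * ((weight a)\<^sup>2 * (v a * cnj (branch q a k))))) i"
    unfolding col mixture_app[OF embed_in_ell2[OF q_mult_ell2(1)[OF b]]] cinner_branch_embed[OF b]
    by simp
  also have "\<dots> = mixture q (\<lambda>a. w a * ((weight a)\<^sup>2 * v a)) i k"
    unfolding mixture_column by (simp add: mult.assoc)
  finally show "mat_mult (mixture q w) (mixture q v) i k =
      mixture q (\<lambda>a. w a * ((weight a)\<^sup>2 * v a)) i k" .
qed

lemma mixture_sqrt: "is_positive_sqrt (mixture q (\<lambda>a. 1 / weight a)) (mixture q (\<lambda>_. 1))"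
proof -
  have w: "0 \<le> 1 / weight a" "1 / weight a * weight a \<le> 1" for a
    using weight_nonneg[of a] by auto
  \<comment> \<open>For a branch of norm zero, 1 / \<open>weight a\<close> is 0 by convention and
    the product of weights is 0 instead of 1; the branch itself then vanishes, so the entries still
    agree.\<close>
  have "branch q a i = 0" if "weight a = 0" for a i
    using cmod_branch_le_weight[of a i] that by simp
  then have "mixture q (\<lambda>a. 1 / weight a * ((weight a)\<^sup>2 * (1 / weight a))) = mixture q (\<lambda>_. 1)"
    unfolding mixture_def by (auto simp: fun_eq_iff power2_eq_square intro!: sum.cong)
  then show ?thesis
    unfolding is_positive_sqrt_def mixture_mult[OF w]
    using bounded_mixture[OF w] positive_mixture[OF w] by blast
qed

end


context ancilla_basis
begin

text \<open>
  The symmetric logarithmic derivative multiplies the coefficients by \<open>\<mu>\<close>, twice the logarithmic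
  derivative of the amplitudes: being diagonal, it acts on all branches simultaneously.
\<close>

lemma quantum_fisher_information_mixture:
  assumes normalized: "((\<lambda>k. (q \<tau> k)\<^sup>2) has_sum 1) UNIV"
    and deriv: "\<And>k. ((\<lambda>t. q t k) has_field_derivative \<mu> k / 2 * q \<tau> k) (at \<tau>)"
    and K: "((\<lambda>k. (\<mu> k * q \<tau> k)\<^sup>2) has_sum K) UNIV"
  shows "has_quantum_fisher_information (\<lambda>t. mixture (q t) (\<lambda>_. 1)) \<tau> K"
proof -
  interpret branches chi "q \<tau>"
    by unfold_locales (rule normalized)
  define D where "D = {x \<in> ell2. (\<lambda>k. complex_of_real (\<mu> k) * coeff x k) \<in> ell2}"
  define L where "L x = embed (\<lambda>k. complex_of_real (\<mu> k) * coeff x k)" for x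
  define w where "w a = 1 / weight a" for a
  have w: "0 \<le> w a" "w a * weight a \<le> 1" for a
    using weight_nonneg[of a] by (auto simp: w_def)
  have one: "0 \<le> (1::real)" "1 * weight a \<le> 1" for a
    using weight_le_1[of a] by auto
  have \<mu>q: "(\<lambda>k. complex_of_real (\<mu> k * q \<tau> k)) \<in> ell2"
    by (rule has_sum_imp_ell2) (use K in \<open>simp add: power_mult_distrib norm_mult\<close>)
  have mult: "(\<lambda>k. \<mu> k * (case k of (n, a) \<Rightarrow> complex_of_real (q \<tau> (n, a)) * c a)) =
      (\<lambda>(n, a). complex_of_real (\<mu> (n, a) * q \<tau> (n, a)) * c a)" for c :: "('m \<Rightarrow> nat) \<Rightarrow> complex"
    by auto
  have mult_ell2: "(\<lambda>(n, a). complex_of_real (\<mu> (n, a) * q \<tau> (n, a)) * c a) \<in> ell2"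
    if "\<And>a. cmod (c a) \<le> B" for c :: "('m \<Rightarrow> nat) \<Rightarrow> complex" and B
  proof (rule ell2_dominated[OF ell2_scale[OF \<mu>q, of B]])
    fix k
    have "0 \<le> B" using that[of undefined] norm_ge_zero order_trans by blast
    then show "cmod (case k of (n, a) \<Rightarrow> complex_of_real (\<mu> (n, a) * q \<tau> (n, a)) * c a) \<le>
        cmod (B * complex_of_real (\<mu> k * q \<tau> k))"
      using that[of "snd k"] by (cases k) (simp add: norm_mult mult.commute mult_right_mono)
  qed
  have L_app: "L (mat_app (mixture (q \<tau>) v) x) =
      embed (\<lambda>(n, a). complex_of_real (\<mu> (n, a) * q \<tau> (n, a)) * (v a * cinner (branch (q \<tau>) a) x))"
    if "x \<in> ell2" for v x
    unfolding L_def mixture_app[OF that] coeff_embed mult ..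
  have in_D: "mat_app (mixture (q \<tau>) v) x \<in> D"
    if v: "\<And>a. 0 \<le> v a" "\<And>a. v a * weight a \<le> 1" and x: "x \<in> ell2" for v x
    unfolding D_def mem_Collect_eq mixture_app[OF x] coeff_embed mult
    by (intro conjI embed_in_ell2 q_mult_ell2(1)[OF weighted_cinner_bound[OF v x]]
        mult_ell2[OF weighted_cinner_bound[OF v x]])
  define q' where "q' k = \<mu> k / 2 * q \<tau> k" for k
  \<comment> \<open>The logarithmic derivative sends each branch to twice its derivative, since
    \<open>\<mu> k * q \<tau> k\<close> is \<open>2 * q' k\<close>.\<close>
  have L\<rho>: "L (mat_app (mixture (q \<tau>) (\<lambda>_. 1)) (ket j)) i =
      2 * (\<Sum>a\<le>snd i. branch q' a i * cnj (branch (q \<tau>) a j))" for i j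
  proof -
    have "L (mat_app (mixture (q \<tau>) (\<lambda>_. 1)) (ket j)) i =
        embed (\<lambda>k. 2 * (case k of (n, a) \<Rightarrow> complex_of_real (q' (n, a)) * cnj (branch (q \<tau>) a j))) i"
      unfolding L_app[OF ket_in_ell2] cinner_ket_right
      by (rule arg_cong[where f = "\<lambda>g. embed g i"]) (auto simp: q'_def)
    then show ?thesis
      unfolding embed_scale sum_branch .
  qed
  have adj: "cnj (\<Sum>a\<le>snd j. branch q' a j * cnj (branch (q \<tau>) a i)) =
      (\<Sum>a\<le>snd i. branch (q \<tau>) a i * cnj (branch q' a j))" for i j
  proof -
    have "cnj (\<Sum>a\<le>snd j. branch q' a j * cnj (branch (q \<tau>) a i)) =
        (\<Sum>a\<le>snd j. branch (q \<tau>) a i * cnj (branch q' a j))"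
      by (simp add: mult.commute)
    also have "\<dots> = (\<Sum>a\<le>snd i. branch (q \<tau>) a i * cnj (branch q' a j))"
      by (rule sum_branch_outside[where q = "q'"]) simp
    finally show ?thesis .
  qed
  have half: "(2 * x + cnj (2 * z)) / 2 = x + cnj z" for x z :: complex
    by simp
  have "is_sld (\<lambda>t. mixture (q t) (\<lambda>_. 1)) \<tau> D L"
    unfolding is_sld_def Let_def
  proof (intro conjI ballI allI)
    show "symmetric_operator D L"
      unfolding D_def L_def by (rule symmetric_operator_multiplier)
    show "mat_app (mixture (q \<tau>) (\<lambda>_. 1)) x \<in> D" if "x \<in> ell2" for x
      by (rule in_D[OF one that])
    fix i j
    show "((\<lambda>t. mixture (q t) (\<lambda>_. 1) i j) has_vector_derivative
       (L (mat_app (mixture (q \<tau>) (\<lambda>_. 1)) (ket j)) i +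
        adjoint (\<lambda>i j. L (mat_app (mixture (q \<tau>) (\<lambda>_. 1)) (ket j)) i) i j) / 2) (at \<tau>)"
      unfolding adjoint_def L\<rho> half adj
      by (rule has_vector_derivative_mixture[OF deriv[folded q'_def]])
  qed
  moreover have "is_positive_sqrt (mixture (q \<tau>) w) (mixture (q \<tau>) (\<lambda>_. 1))"
    using mixture_sqrt by (simp add: w_def[abs_def])
  moreover have "\<forall>x\<in>ell2. mat_app (mixture (q \<tau>) w) x \<in> D"
    using in_D[OF w] by blast
  moreover have "((\<lambda>i. (ell2_norm (L (mat_app (mixture (q \<tau>) w) (ket i))))\<^sup>2) has_sum K) UNIV"
  \<comment> \<open>The trace is a double sum of |f (i, k)|^2. Summed over k at fixed i it is the
    squared norm of a column, by isometry of \<open>embed\<close>; summed over i at fixed k it is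
    \<open>(\<mu> k * q \<tau> k)\<^sup>2\<close>, because the squared norm of the branch cancels
    \<open>(w a)\<^sup>2\<close>.\<close>
  proof (rule has_sum_SigmaD)
    define f where "f = (\<lambda>(i, n, a). complex_of_real (\<mu> (n, a) * q \<tau> (n, a)) *
        (w a * cnj (branch (q \<tau>) a i)))"
    show "((\<lambda>i. (cmod (f i))\<^sup>2) has_sum K) (UNIV \<times> UNIV)"
      unfolding UNIV_Times_UNIV
    proof (rule ell2_of_slices[OF _ K])
      fix k :: "('m \<Rightarrow> nat) \<times> ('m \<Rightarrow> nat)"
      obtain n a where k: "k = (n, a)" by (cases k)
      have "(\<lambda>i. (cmod (f (i, k)))\<^sup>2) =
          (\<lambda>i. ((\<mu> k * q \<tau> k)\<^sup>2 * (w a)\<^sup>2) * (cmod (branch (q \<tau>) a i))\<^sup>2)"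
        by (simp add: f_def k norm_mult power_mult_distrib mult.assoc)
      \<comment> \<open>If \<open>weight a = 0\<close>, the cancellation fails but
        \<open>q \<tau> k\<close> is zero by \<open>abs_q_le_weight\<close>.\<close>
      moreover have "(\<mu> k * q \<tau> k)\<^sup>2 * (w a)\<^sup>2 * (weight a)\<^sup>2 = (\<mu> k * q \<tau> k)\<^sup>2"
        using abs_q_le_weight[of n a] by (cases "weight a = 0") (auto simp: k w_def power_divide)
      ultimately show "((\<lambda>i. (cmod (f (i, k)))\<^sup>2) has_sum (\<mu> k * q \<tau> k)\<^sup>2) UNIV"
        using has_sum_cmult_right[OF has_sum_ell2_norm[OF branch_in_ell2[of a]],
            of "(\<mu> k * q \<tau> k)\<^sup>2 * (w a)\<^sup>2"]
        by (simp only: weight_def)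
    qed
    fix i :: "'a \<times> ('m \<Rightarrow> nat)"
    have g: "(\<lambda>k. f (i, k)) \<in> ell2"
      using mult_ell2[OF weighted_branch_bound[OF w, where i = i]] by (simp add: f_def)
    have "L (mat_app (mixture (q \<tau>) w) (ket i)) = embed (\<lambda>k. f (i, k))"
      unfolding L_app[OF ket_in_ell2] cinner_ket_right f_def by simp
    then show "((\<lambda>k. (cmod (f (i, k)))\<^sup>2) has_sum
        (ell2_norm (L (mat_app (mixture (q \<tau>) w) (ket i))))\<^sup>2) UNIV"
      using has_sum_ell2_norm[OF g] ell2_norm_embed[OF g] by simp
  qed
  ultimately show ?thesis
    unfolding has_quantum_fisher_information_def by blast
qed

end


section \<open>The negative binomial distribution\<close>

text \<open>Newton's series with exponent -(r + 1) at -x; the sign from negating the upper index of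
  the generalized binomial coefficient cancels the sign of (-x)^a.\<close>

lemma negative_binomial_series:
  fixes x :: real
  assumes "\<bar>x\<bar> < 1"
  shows "(\<lambda>a. real ((r + a) choose a) * x ^ a) sums (1 / (1 - x) ^ (r + 1))"
proof -
  have "(\<lambda>a. ((- real (r + 1)) gchoose a) * (- x) ^ a) sums (1 + - x) powr (- real (r + 1))"
    by (rule gen_binomial_real) (use assms in simp)
  moreover have "((- real (r + 1)) gchoose a) * (- x) ^ a = real ((r + a) choose a) * x ^ a" for a
  proof -
    have "(real (r + 1) + real a - 1) gchoose a = real ((r + a) choose a)"
      unfolding binomial_gbinomial by simp
    then have "((- real (r + 1)) gchoose a) = (- 1) ^ a * real ((r + a) choose a)"
      unfolding gbinomial_minus by simp
    then show ?thesis
      using power_mult_distrib[of "- 1" "- x" a] by simp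
  qed
  moreover have "(1 + - x) powr (- real (r + 1)) = 1 / (1 - x) ^ (r + 1)"
    using assms by (subst powr_minus_divide, subst powr_realpow) auto
  ultimately show ?thesis by simp
qed

text \<open>Absorbs a factor a into the binomial coefficient by raising r, so every factorial moment
  reduces to a lower one with r + 1 in place of r.\<close>

lemma Suc_times_binomial_shift: "Suc a * ((r + Suc a) choose Suc a) = Suc r * ((Suc r + a) choose a)"
proof -
  have "Suc r * ((Suc r + a) choose a) = Suc (r + a) * ((r + a) choose a)"
    using binomial_absorb_comp[of "Suc r + a" a] by simp
  then show ?thesis
    using Suc_times_binomial_eq[of "r + a" a] by (simp add: mult.commute)
qed

lemma negative_binomial_series_factorial_moment_1:
  fixes x :: real
  assumes "\<bar>x\<bar> < 1"
  shows "(\<lambda>a. real a * (real ((r + a) choose a) * x ^ a)) sums (real (r + 1) * x / (1 - x) ^ (r + 2))"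
proof -
  have "(\<lambda>a. (real (r + 1) * x) * (real ((Suc r + a) choose a) * x ^ a)) sums
      ((real (r + 1) * x) * (1 / (1 - x) ^ (Suc r + 1)))"
    by (intro sums_mult negative_binomial_series assms)
  moreover have "(real (r + 1) * x) * (real ((Suc r + a) choose a) * x ^ a) =
      real (Suc a) * (real ((r + Suc a) choose Suc a) * x ^ Suc a)" for a
  proof -
    have "real (Suc a) * real ((r + Suc a) choose Suc a) = real (Suc r) * real ((Suc r + a) choose a)"
      using Suc_times_binomial_shift[of a r] by (simp only: of_nat_mult[symmetric])
    then show ?thesis by (simp add: mult_ac)
  qed
  moreover have "(real (r + 1) * x) * (1 / (1 - x) ^ (Suc r + 1)) = real (r + 1) * x / (1 - x) ^ (r + 2)"
    by simp
  ultimately have "(\<lambda>a. real (Suc a) * (real ((r + Suc a) choose Suc a) * x ^ Suc a)) sums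
      (real (r + 1) * x / (1 - x) ^ (r + 2))"
    by (simp only:)
  \<comment> \<open>The shift starts the series at a = 1; the restored term at a = 0 is
    zero.\<close>
  from sums_Suc[OF this] show ?thesis by simp
qed

lemma negative_binomial_series_factorial_moment_2:
  fixes x :: real
  assumes "\<bar>x\<bar> < 1"
  shows "(\<lambda>a. real a * (real a - 1) * (real ((r + a) choose a) * x ^ a)) sums
    (real (r + 1) * real (r + 2) * x\<^sup>2 / (1 - x) ^ (r + 3))"
proof -
  have "(\<lambda>a. (real (r + 1) * x) * (real a * (real ((Suc r + a) choose a) * x ^ a))) sums
      ((real (r + 1) * x) * (real (Suc r + 1) * x / (1 - x) ^ (Suc r + 2)))"
    by (intro sums_mult negative_binomial_series_factorial_moment_1 assms)
  moreover have "(real (r + 1) * x) * (real a * (real ((Suc r + a) choose a) * x ^ a)) =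
      real (Suc a) * (real (Suc a) - 1) * (real ((r + Suc a) choose Suc a) * x ^ Suc a)" for a
  proof -
    have "real (Suc a) * real ((r + Suc a) choose Suc a) = real (Suc r) * real ((Suc r + a) choose a)"
      using Suc_times_binomial_shift[of a r] by (simp only: of_nat_mult[symmetric])
    then show ?thesis by (simp add: mult_ac)
  qed
  moreover have "(real (r + 1) * x) * (real (Suc r + 1) * x / (1 - x) ^ (Suc r + 2)) =
      real (r + 1) * real (r + 2) * x\<^sup>2 / (1 - x) ^ (r + 3)"
    by (simp add: power2_eq_square mult_ac numeral_eq_Suc)
  ultimately have "(\<lambda>a. real (Suc a) * (real (Suc a) - 1) * (real ((r + Suc a) choose Suc a) * x ^ Suc a)) sums
      (real (r + 1) * real (r + 2) * x\<^sup>2 / (1 - x) ^ (r + 3))"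
    by (simp only:)
  from sums_Suc[OF this] show ?thesis by simp
qed

section \<open>Squeezing amplitudes in one mode and the moments of their score\<close>

definition amplitude :: "real \<Rightarrow> nat \<Rightarrow> nat \<Rightarrow> real" where
  "amplitude t n a = (1 / cosh t) ^ (n + 1) * sqrt (real ((n + a) choose a)) * tanh t ^ a"

text \<open>The logarithmic derivative of the amplitude, not of the probability. The subtracted term
  is the mean number of created pairs.\<close>

definition score :: "real \<Rightarrow> nat \<Rightarrow> nat \<Rightarrow> real" where
  "score t n a = (real a - real (n + 1) * (sinh t)\<^sup>2) / (sinh t * cosh t)"

lemma amplitude_pos: "t > 0 \<Longrightarrow> amplitude t n a > 0"
  by (simp add: amplitude_def)

text \<open>Up to a constant, the logarithm is a ln sinh t - (n + a + 1) ln cosh t, whose derivative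
  simplifies with cosh^2 = 1 + sinh^2; exponentiating back gives the claim. Positivity of t makes
  the logarithms meaningful.\<close>

lemma amplitude_has_derivative:
  assumes "t > 0"
  shows "((\<lambda>t. amplitude t n a) has_field_derivative score t n a * amplitude t n a) (at t)"
proof -
  have pos: "cosh t > 0" "sinh t > 0" "tanh t > 0" using assms by auto
  have "((\<lambda>t. ln (amplitude t n a)) has_field_derivative score t n a) (at t)"
  proof (rule DERIV_cong)
    have "\<forall>\<^sub>F s in nhds t. s > 0"
      using eventually_nhds_in_open[of "{0<..}" t] assms by simp
    then have eq: "\<forall>\<^sub>F s in nhds t. ln (amplitude s n a) =
        ln (sqrt (real ((n + a) choose a))) + real a * ln (sinh s) - real (n + a + 1) * ln (cosh s)"
    proof eventually_elim
      case (elim s)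
      then have "cosh s > 0" "sinh s > 0" "sqrt (real ((n + a) choose a)) > 0" by auto
      then show ?case
        unfolding amplitude_def tanh_def by (simp add: ln_mult ln_div ln_realpow algebra_simps)
    qed
    show "((\<lambda>t. ln (amplitude t n a)) has_field_derivative
       real a * (cosh t / sinh t) - real (n + a + 1) * (sinh t / cosh t)) (at t)"
      by (subst DERIV_cong_ev[OF refl eq refl])
        (use pos in \<open>auto intro!: derivative_eq_intros simp: field_simps\<close>)
    have "(cosh t)\<^sup>2 = 1 + (sinh t)\<^sup>2" by (simp add: cosh_square_eq)
    then show "real a * (cosh t / sinh t) - real (n + a + 1) * (sinh t / cosh t) = score t n a"
      using pos by (simp add: score_def field_simps power2_eq_square)
  qed
  from DERIV_fun_exp[OF this]
  have *: "((\<lambda>t. exp (ln (amplitude t n a))) has_field_derivative score t n a * amplitude t n a) (at t)"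
    using amplitude_pos[OF assms] by (simp add: mult.commute)
  have "\<forall>\<^sub>F s in nhds t. s > 0"
    using eventually_nhds_in_open[of "{0<..}" t] assms by simp
  then have "\<forall>\<^sub>F s in nhds t. exp (ln (amplitude s n a)) = amplitude s n a"
    by eventually_elim (simp add: amplitude_pos)
  with * show ?thesis
    by (simp add: DERIV_cong_ev)
qed

lemma one_minus_tanh_square: "1 - (tanh t)\<^sup>2 = (1 / cosh t)\<^sup>2" for t :: real
proof -
  have "1 - (tanh t)\<^sup>2 = ((cosh t)\<^sup>2 - (sinh t)\<^sup>2) / (cosh t)\<^sup>2"
    by (simp add: tanh_def power_divide diff_divide_distrib)
  then show ?thesis by (simp add: cosh_square_eq power_divide)
qed

text \<open>The negative binomial law with index n + 1 and success parameter x = (tanh t)^2.\<close>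

lemma amplitude_power2:
  "(amplitude t n a)\<^sup>2 = (1 - (tanh t)\<^sup>2) ^ (n + 1) * (real ((n + a) choose a) * ((tanh t)\<^sup>2) ^ a)"
proof -
  have "(x ^ k * r * y ^ a)\<^sup>2 = (x\<^sup>2) ^ k * (r\<^sup>2 * (y\<^sup>2) ^ a)" for x r y :: real and k
    by (simp only: power_mult_distrib power_mult[symmetric] mult.commute[of 2] mult.assoc)
  then show ?thesis
    unfolding one_minus_tanh_square amplitude_def by (simp only: real_sqrt_pow2 of_nat_0_le_iff)
qed

context
  fixes t :: real
  assumes t: "t > 0"
begin

lemma tanh_square_bounds: "\<bar>(tanh t)\<^sup>2\<bar> < 1" "1 - (tanh t)\<^sup>2 > 0"
proof -
  have "(tanh t)\<^sup>2 < 1"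
    using tanh_real_bounds[of t] by (simp add: abs_square_less_1 abs_less_iff)
  then show "\<bar>(tanh t)\<^sup>2\<bar> < 1" "1 - (tanh t)\<^sup>2 > 0" by auto
qed

text \<open>The odds x / (1 - x) of the law, in which its factorial moments are polynomial.\<close>

lemma tanh_square_odds: "(tanh t)\<^sup>2 / (1 - (tanh t)\<^sup>2) = (sinh t)\<^sup>2"
proof -
  have "(tanh t)\<^sup>2 / (1 / cosh t)\<^sup>2 = (sinh t)\<^sup>2"
    by (simp add: tanh_def power_divide)
  then show ?thesis by (simp only: one_minus_tanh_square)
qed

lemma amplitude_sums: "((\<lambda>a. (amplitude t n a)\<^sup>2) has_sum 1) UNIV"
proof (rule sums_nonneg_imp_has_sum)
  show "(\<lambda>a. (amplitude t n a)\<^sup>2) sums 1"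
    using sums_mult[OF negative_binomial_series[OF tanh_square_bounds(1)], of "(1 - (tanh t)\<^sup>2) ^ (n + 1)" n]
      tanh_square_bounds(2)
    by (simp add: amplitude_power2)
qed simp

lemma amplitude_first_moment:
  "((\<lambda>a. real a * (amplitude t n a)\<^sup>2) has_sum (real (n + 1) * (sinh t)\<^sup>2)) UNIV"
proof (rule sums_nonneg_imp_has_sum)
  have "y ^ (n + 1) * (c * x / y ^ (n + 2)) = c * (x / y)" if "y > 0" for c x y :: real
    using that by (simp add: field_simps)
  from this[OF tanh_square_bounds(2)] show "(\<lambda>a. real a * (amplitude t n a)\<^sup>2) sums (real (n + 1) * (sinh t)\<^sup>2)"
    using sums_mult[OF negative_binomial_series_factorial_moment_1[OF tanh_square_bounds(1)],
        of "(1 - (tanh t)\<^sup>2) ^ (n + 1)" n]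
    by (simp only: amplitude_power2 tanh_square_odds mult.left_commute)
qed simp

lemma amplitude_second_factorial_moment:
  "((\<lambda>a. real a * (real a - 1) * (amplitude t n a)\<^sup>2) has_sum
    (real (n + 1) * real (n + 2) * ((sinh t)\<^sup>2)\<^sup>2)) UNIV"
proof (rule sums_nonneg_imp_has_sum)
  have "y ^ (n + 1) * (c * x\<^sup>2 / y ^ (n + 3)) = c * (x / y)\<^sup>2" if "y > 0" for c x y :: real
    using that by (simp add: field_simps numeral_eq_Suc)
  from this[OF tanh_square_bounds(2)]
  show "(\<lambda>a. real a * (real a - 1) * (amplitude t n a)\<^sup>2) sums (real (n + 1) * real (n + 2) * ((sinh t)\<^sup>2)\<^sup>2)"
    using sums_mult[OF negative_binomial_series_factorial_moment_2[OF tanh_square_bounds(1)],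
        of "(1 - (tanh t)\<^sup>2) ^ (n + 1)" n]
    by (simp only: amplitude_power2 tanh_square_odds mult.left_commute)
  show "0 \<le> real a * (real a - 1) * (amplitude t n a)\<^sup>2" for a
    by (cases a) auto
qed

lemma score_mean: "((\<lambda>a. (amplitude t n a)\<^sup>2 * score t n a) has_sum 0) UNIV"
proof -
  define m where "m = real (n + 1) * (sinh t)\<^sup>2"
  have "((\<lambda>a. 1 / (sinh t * cosh t) * (real a * (amplitude t n a)\<^sup>2 + (- m) * (amplitude t n a)\<^sup>2)) has_sum
      1 / (sinh t * cosh t) * (m + (- m) * 1)) UNIV"
    unfolding m_def
    by (intro has_sum_cmult_right has_sum_add amplitude_first_moment amplitude_sums)
  moreover have "1 / (sinh t * cosh t) * (real a * (amplitude t n a)\<^sup>2 + (- m) * (amplitude t n a)\<^sup>2) =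
      (amplitude t n a)\<^sup>2 * score t n a" for a
    unfolding score_def m_def[symmetric] by (simp add: algebra_simps diff_divide_distrib)
  ultimately show ?thesis by simp
qed

text \<open>The pair number has variance (n + 1) sinh^2 cosh^2, exactly the squared denominator of
  the score times n + 1; hence the result does not depend on t.\<close>

lemma score_variance: "((\<lambda>a. (amplitude t n a)\<^sup>2 * (score t n a)\<^sup>2) has_sum real (n + 1)) UNIV"
proof -
  define m where "m = real (n + 1) * (sinh t)\<^sup>2"
  define s where "s = real (n + 1) * real (n + 2) * ((sinh t)\<^sup>2)\<^sup>2"
  have pos: "sinh t > 0" "cosh t > 0" using t by auto
  \<comment> \<open>Expands (a - m)^2 as a (a - 1) + (1 - 2 m) a + m^2 to match the available
    moments.\<close>
  have "((\<lambda>a. 1 / (sinh t * cosh t)\<^sup>2 * (real a * (real a - 1) * (amplitude t n a)\<^sup>2 +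
        ((1 - 2 * m) * (real a * (amplitude t n a)\<^sup>2) + m\<^sup>2 * (amplitude t n a)\<^sup>2))) has_sum
      1 / (sinh t * cosh t)\<^sup>2 * (s + ((1 - 2 * m) * m + m\<^sup>2 * 1))) UNIV"
    unfolding m_def s_def
    by (intro has_sum_cmult_right has_sum_add amplitude_first_moment amplitude_sums
        amplitude_second_factorial_moment)
  moreover have "1 / (sinh t * cosh t)\<^sup>2 * (real a * (real a - 1) * (amplitude t n a)\<^sup>2 +
        ((1 - 2 * m) * (real a * (amplitude t n a)\<^sup>2) + m\<^sup>2 * (amplitude t n a)\<^sup>2)) =
      (amplitude t n a)\<^sup>2 * (score t n a)\<^sup>2" for a
    unfolding score_def m_def[symmetric] power_divide
    by (simp add: power2_eq_square[of "real a - m"] power2_eq_square[of m] algebra_simps add_divide_distrib diff_divide_distrib)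
  moreover have "s + ((1 - 2 * m) * m + m\<^sup>2 * 1) = real (n + 1) * (sinh t * cosh t)\<^sup>2"
    unfolding s_def m_def power_mult_distrib cosh_square_eq
    by (simp add: power2_eq_square algebra_simps)
  then have "1 / (sinh t * cosh t)\<^sup>2 * (s + ((1 - 2 * m) * m + m\<^sup>2 * 1)) = real (n + 1)"
    using pos by simp
  ultimately show ?thesis by simp
qed

end

section \<open>Sums of independent centred scores\<close>

lemma has_sum_prod_UNIV:
  fixes f :: "'m::finite \<Rightarrow> nat \<Rightarrow> real"
  assumes "\<And>i. (f i has_sum S i) UNIV"
  shows "((\<lambda>a. \<Prod>i\<in>UNIV. f i (a i)) has_sum (\<Prod>i\<in>UNIV. S i)) UNIV"
proof -
  have abs: "(\<lambda>x. norm (f i x)) summable_on UNIV" for i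
    using assms[of i] summable_on_iff_abs_summable_on_real by (auto simp: summable_on_def)
  have U: "PiE UNIV (\<lambda>_. UNIV) = (UNIV :: ('m \<Rightarrow> nat) set)"
    by (auto simp: PiE_def)
  have "(\<lambda>a. norm (\<Prod>i\<in>UNIV. f i (a i))) summable_on PiE UNIV (\<lambda>_. UNIV)"
    unfolding abs_summable_equivalent
    by (rule abs_summable_on_prod_PiE) (auto intro: abs_summable_equivalent[THEN iffD1, OF abs])
  then have "(\<lambda>a. \<Prod>i\<in>UNIV. f i (a i)) summable_on UNIV"
    unfolding U by (rule abs_summable_summable)
  moreover have "(\<Sum>\<^sub>\<infinity>a. \<Prod>i\<in>UNIV. f i (a i)) = (\<Prod>i\<in>UNIV. S i)"
    using infsum_prod_PiE_abs[of UNIV f "\<lambda>_. UNIV"] abs by (simp add: U infsumI[OF assms])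
  ultimately show ?thesis by (simp add: has_sum_iff)
qed

text \<open>Expanding the square gives one product over modes for each pair (i, j). For i \<noteq> j
  the factor of mode i is a mean and vanishes; for i = j only the variance of mode i
  survives.\<close>

lemma has_sum_variance_of_sum:
  fixes P X :: "'m::finite \<Rightarrow> nat \<Rightarrow> real"
  assumes P: "\<And>i. (P i has_sum 1) UNIV"
    and mean: "\<And>i. ((\<lambda>k. P i k * X i k) has_sum 0) UNIV"
    and var: "\<And>i. ((\<lambda>k. P i k * (X i k)\<^sup>2) has_sum V i) UNIV"
  shows "((\<lambda>a. (\<Prod>i\<in>UNIV. P i (a i)) * (\<Sum>i\<in>UNIV. X i (a i))\<^sup>2) has_sum (\<Sum>i\<in>UNIV. V i)) UNIV"
proof -
  \<comment> \<open>Mode k receives one factor X for each of i and j equal to k, so two of them when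
    i = j = k.\<close>
  define f where "f i j k b = P k b * ((if k = i then X k b else 1) * (if k = j then X k b else 1))" for i j k b
  have f: "(f i j k has_sum (if k = i \<and> k = j then V k else if k = i \<or> k = j then 0 else 1)) UNIV" for i j k
    using P[of k] mean[of k] var[of k] by (auto simp: f_def[abs_def] power2_eq_square)
  have prod: "(\<Prod>k\<in>UNIV. if k = i \<and> k = j then V k else if k = i \<or> k = j then 0 else 1) =
      (if i = j then V i else 0)" for i j
  proof (cases "i = j")
    case True
    then show ?thesis by (simp add: prod.delta cong: if_cong)
  next
    case False
    then have "\<exists>k\<in>UNIV. (if k = i \<and> k = j then V k else if k = i \<or> k = j then 0 else 1) = 0"
      by (intro bexI[of _ i]) auto
    then show ?thesis using False by (simp only: prod_zero[OF finite] if_False)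
  qed
  have "((\<lambda>a. \<Prod>k\<in>UNIV. f i j k (a k)) has_sum (if i = j then V i else 0)) UNIV" for i j
    using has_sum_prod_UNIV[where f = "f i j", OF f] unfolding prod .
  then have "((\<lambda>a. \<Sum>i\<in>UNIV. \<Sum>j\<in>UNIV. \<Prod>k\<in>UNIV. f i j k (a k)) has_sum
      (\<Sum>i\<in>UNIV. \<Sum>j\<in>UNIV. if i = j then V i else 0)) UNIV"
    by (intro has_sum_finite_sum)
  moreover have "(\<Sum>i\<in>UNIV. \<Sum>j\<in>UNIV. \<Prod>k\<in>UNIV. f i j k (a k)) =
      (\<Prod>i\<in>UNIV. P i (a i)) * (\<Sum>i\<in>UNIV. X i (a i))\<^sup>2" for a
    unfolding f_def prod.distrib power2_eq_square sum_product
    by (simp add: prod.delta sum_distrib_left)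
  ultimately show ?thesis by simp
qed


section \<open>Amplitudes of the amplified probe\<close>

lemma has_sum_nonneg_pairs:
  fixes f :: "'i \<times> 'j \<Rightarrow> real"
  assumes "\<And>x. ((\<lambda>y. f (x, y)) has_sum g x) UNIV" "(g has_sum S) UNIV" "\<And>k. 0 \<le> f k"
  shows "(f has_sum S) UNIV"
proof -
  have "f summable_on UNIV \<times> UNIV"
    by (rule summable_on_SigmaI) (use assms in \<open>auto intro: has_sum_imp_summable\<close>)
  then have "(f has_sum S) (UNIV \<times> UNIV)"
    by (intro has_sum_SigmaI) (use assms in auto)
  then show ?thesis by simp
qed

definition probe_amplitude :: "(('m::finite \<Rightarrow> nat) \<Rightarrow> real) \<Rightarrow> real \<Rightarrow> ('m \<Rightarrow> nat) \<times> ('m \<Rightarrow> nat) \<Rightarrow> real" where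
  "probe_amplitude p t = (\<lambda>(n, a). sqrt (p n) * (\<Prod>i\<in>UNIV. amplitude t (n i) (a i)))"

definition total_score :: "real \<Rightarrow> ('m::finite \<Rightarrow> nat) \<times> ('m \<Rightarrow> nat) \<Rightarrow> real" where
  "total_score t = (\<lambda>(n, a). \<Sum>i\<in>UNIV. score t (n i) (a i))"

lemma probe_amplitude_power2:
  assumes "is_pmf p"
  shows "(probe_amplitude p t (n, a))\<^sup>2 = p n * (\<Prod>i\<in>UNIV. (amplitude t (n i) (a i))\<^sup>2)"
  using assms by (simp add: probe_amplitude_def power_mult_distrib prod_power_distrib is_pmf_def)

lemma probe_amplitude_normalized:
  fixes p :: "('m::finite \<Rightarrow> nat) \<Rightarrow> real"
  assumes "is_pmf p" "t > 0"
  shows "((\<lambda>k. (probe_amplitude p t k)\<^sup>2) has_sum 1) UNIV"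
proof (rule has_sum_nonneg_pairs)
  fix n :: "'m \<Rightarrow> nat"
  have "((\<lambda>a. \<Prod>i\<in>UNIV. (amplitude t (n i) (a i))\<^sup>2) has_sum (\<Prod>i\<in>(UNIV :: 'm set). 1)) UNIV"
    by (rule has_sum_prod_UNIV[OF amplitude_sums[OF assms(2)]])
  from has_sum_cmult_right[OF this, of "p n"]
  show "((\<lambda>a. (probe_amplitude p t (n, a))\<^sup>2) has_sum p n) UNIV"
    by (simp add: probe_amplitude_power2[OF assms(1)])
qed (use assms in \<open>auto simp: is_pmf_def\<close>)

text \<open>Given n, the modes are independent and the total score has variance |n| + M; averaging
  over p gives N + M, and 4 is the square of the factor 2 before the score.\<close>

lemma probe_amplitude_fisher:
  fixes p :: "('m::finite \<Rightarrow> nat) \<Rightarrow> real"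
  assumes "is_pmf p" "t > 0" "((\<lambda>n. p n * real (\<Sum>i\<in>UNIV. n i)) has_sum N) UNIV"
  shows "((\<lambda>k. (2 * total_score t k * probe_amplitude p t k)\<^sup>2) has_sum 4 * (N + real CARD('m))) UNIV"
proof (rule has_sum_nonneg_pairs)
  fix n :: "'m \<Rightarrow> nat"
  have "((\<lambda>a. (\<Prod>i\<in>UNIV. (amplitude t (n i) (a i))\<^sup>2) * (\<Sum>i\<in>UNIV. score t (n i) (a i))\<^sup>2) has_sum
      (\<Sum>i\<in>UNIV. real (n i + 1))) UNIV"
    by (intro has_sum_variance_of_sum amplitude_sums score_mean score_variance assms(2))
  from has_sum_cmult_right[OF this, of "4 * p n"]
  show "((\<lambda>a. (2 * total_score t (n, a) * probe_amplitude p t (n, a))\<^sup>2) has_sum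
      4 * (p n * real (\<Sum>i\<in>UNIV. n i) + p n * real CARD('m))) UNIV"
    unfolding power_mult_distrib probe_amplitude_power2[OF assms(1)]
    by (simp add: total_score_def sum.distrib algebra_simps)
  have "(p has_sum 1) UNIV" using assms(1) by (simp add: is_pmf_def)
  from has_sum_cmult_right[OF has_sum_add[OF assms(3) has_sum_cmult_left[OF this, of "real CARD('m)"]], of 4]
  show "((\<lambda>n. 4 * (p n * real (\<Sum>i\<in>UNIV. n i) + p n * real CARD('m))) has_sum 4 * (N + real CARD('m))) UNIV"
    by simp
qed simp

lemma probe_amplitude_has_derivative:
  fixes p :: "('m::finite \<Rightarrow> nat) \<Rightarrow> real"
  assumes "t > 0"
  shows "((\<lambda>t. probe_amplitude p t k) has_field_derivative total_score t k * probe_amplitude p t k) (at t)"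
proof (cases k)
  case (Pair n a)
  have "((\<lambda>t. \<Prod>i\<in>F. amplitude t (n i) (a i)) has_field_derivative
      (\<Sum>i\<in>F. score t (n i) (a i)) * (\<Prod>i\<in>F. amplitude t (n i) (a i))) (at t)" for F :: "'m set"
  proof (induction F rule: infinite_finite_induct)
    case (insert i F)
    then show ?case
      using DERIV_mult[OF amplitude_has_derivative[OF assms, of "n i" "a i"] insert.IH]
      by (simp add: algebra_simps)
  qed auto
  from DERIV_cmult[OF this, of "sqrt (p n)" UNIV] show ?thesis
    by (simp add: Pair probe_amplitude_def total_score_def mult_ac)
qed

section \<open>The output state\<close>

lemma infsum_single:
  fixes f :: "'i \<Rightarrow> 'b :: {topological_comm_monoid_add,t2_space}"
  assumes "\<And>j. j \<noteq> i \<Longrightarrow> f j = 0"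
  shows "(\<Sum>\<^sub>\<infinity>j. f j) = f i"
  by (rule infsumI, rule has_sum_finite_neutralI[of "{i}"]) (use assms in auto)

lemma squeeze_vacuum_amplitude:
  "squeeze_vacuum t (k, a) n = (if k = n + a then complex_of_real (amplitude t n a) else 0)"
  by (simp add: squeeze_vacuum_def amplitude_def)

text \<open>Tracing out the environment keeps only terms where row and column leave the same number
  of photons there, which gives the condition \<open>y - n = z - m\<close>.\<close>

lemma amplifier_matrix_unit:
  assumes "t \<ge> 0"
  shows "amplifier ((cosh t)\<^sup>2) (ketbra (ket n) (ket m)) y z =
    (if n \<le> y \<and> m \<le> z \<and> y - n = z - m
     then complex_of_real (amplitude t n (y - n) * amplitude t m (z - m)) else 0)"
proof -
  let ?V = "squeeze_vacuum t"
  have arcosh: "arcosh (sqrt ((cosh t)\<^sup>2)) = t"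
    using assms by (simp add: arcosh_cosh_real)
  have 1: "mat_mult ?V (ketbra (ket n) (ket m)) = (\<lambda>i k. ?V i n * of_bool (k = m))"
    unfolding mat_mult_def ketbra_def ket_def
    by (intro ext, subst infsum_single[where i = n]) auto
  have 2: "mat_mult (mat_mult ?V (ketbra (ket n) (ket m))) (adjoint ?V) = (\<lambda>i k. ?V i n * cnj (?V k m))"
    unfolding 1 unfolding mat_mult_def adjoint_def
    by (intro ext, subst infsum_single[where i = m]) auto
  have "amplifier ((cosh t)\<^sup>2) (ketbra (ket n) (ket m)) y z =
      (\<Sum>\<^sub>\<infinity>e. ?V (y, e) n * cnj (?V (z, e) m))"
    unfolding amplifier_def Let_def arcosh 2 partial_trace_snd_def ..
  \<comment> \<open>Photon-number conservation leaves only e = y - n. If n exceeds y, truncation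
    gives e = 0, where the entry is zero.\<close>
  also have "\<dots> = ?V (y, y - n) n * cnj (?V (z, y - n) m)"
    by (rule infsum_single) (auto simp: squeeze_vacuum_amplitude)
  also have "\<dots> = (if n \<le> y \<and> m \<le> z \<and> y - n = z - m
     then complex_of_real (amplitude t n (y - n) * amplitude t m (z - m)) else 0)"
    by (auto simp: squeeze_vacuum_amplitude)
  finally show ?thesis .
qed

lemma prod_amplifier_matrix_unit:
  fixes n m y z :: "'m::finite \<Rightarrow> nat"
  assumes "t \<ge> 0"
  shows "(\<Prod>i\<in>UNIV. amplifier ((cosh t)\<^sup>2) (ketbra (ket (n i)) (ket (m i))) (y i) (z i)) =
    (if n \<le> y \<and> m \<le> z \<and> y - n = z - m
     then complex_of_real ((\<Prod>i\<in>UNIV. amplitude t (n i) ((y - n) i)) *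
       (\<Prod>i\<in>UNIV. amplitude t (m i) ((z - m) i))) else 0)"
proof (cases "n \<le> y \<and> m \<le> z \<and> y - n = z - m")
  case True
  then have "n i \<le> y i \<and> m i \<le> z i \<and> y i - n i = z i - m i" for i
    by (auto simp: le_fun_def fun_eq_iff)
  with True show ?thesis
    by (simp add: amplifier_matrix_unit[OF assms] prod.distrib)
next
  case False
  then obtain i where "\<not> (n i \<le> y i \<and> m i \<le> z i \<and> y i - n i = z i - m i)"
    by (auto simp: le_fun_def fun_eq_iff)
  then have "amplifier ((cosh t)\<^sup>2) (ketbra (ket (n i)) (ket (m i))) (y i) (z i) = 0"
    unfolding amplifier_matrix_unit[OF assms] by (rule if_not_P)
  then have "(\<Prod>i\<in>UNIV. amplifier ((cosh t)\<^sup>2) (ketbra (ket (n i)) (ket (m i))) (y i) (z i)) = 0"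
    by (intro prod_zero) auto
  then show ?thesis
    unfolding if_not_P[OF False] .
qed

lemma probe_state_apply: "probe_state p chi (\<alpha>, y) = complex_of_real (sqrt (p y)) * chi y \<alpha>"
  unfolding probe_state_def by (subst infsum_single[where i = y]) (auto simp: tensor_def ket_def)

lemma cinner_tensor_ket: "cinner (tensor x (ket y)) v = cinner x (\<lambda>\<alpha>. v (\<alpha>, y))"
proof -
  have "cinner (tensor x (ket y)) v = (\<Sum>\<^sub>\<infinity>k\<in>range (\<lambda>\<alpha>. (\<alpha>, y)). cnj (tensor x (ket y) k) * v k)"
    unfolding cinner_def by (rule infsum_cong_neutral) (auto simp: tensor_def ket_def)
  also have "\<dots> = cinner x (\<lambda>\<alpha>. v (\<alpha>, y))"
    unfolding cinner_def
    by (subst infsum_reindex) (auto simp: inj_on_def o_def tensor_def ket_def)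
  finally show ?thesis .
qed

lemma tensor_ket_in_ell2:
  assumes "x \<in> ell2"
  shows "tensor x (ket y) \<in> ell2"
proof (rule has_sum_imp_ell2, rule ell2_of_slices)
  show "((\<lambda>\<alpha>. (cmod (tensor x (ket y) (\<alpha>, z)))\<^sup>2) has_sum (if z = y then (ell2_norm x)\<^sup>2 else 0)) UNIV" for z
    using has_sum_ell2_norm[OF assms] by (simp add: tensor_def ket_def)
  show "((\<lambda>z. if z = y then (ell2_norm x)\<^sup>2 else 0) has_sum (ell2_norm x)\<^sup>2) UNIV"
    by (rule has_sum_finite_neutralI[of "{y}"]) auto
qed

context ancilla_basis
begin

text \<open>The sum over pairs of input numbers (n, m) collapses to the pairs (y - a, z - a),
  parametrized by the common photon number a left in the environment.\<close>

lemma output_state_mixture: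
  assumes "t \<ge> 0"
  shows "output_state p chi ((cosh t)\<^sup>2) = mixture (probe_amplitude p t) (\<lambda>_. 1)"
proof (intro ext)
  fix i j :: "'a \<times> ('m \<Rightarrow> nat)"
  obtain \<alpha> y \<beta> z where ij: "i = (\<alpha>, y)" "j = (\<beta>, z)" by (cases i; cases j)
  let ?q = "probe_amplitude p t"
  let ?h = "\<lambda>(n, m). (\<Prod>i\<in>UNIV. amplifier ((cosh t)\<^sup>2) (ketbra (ket (n i)) (ket (m i))) (y i) (z i)) *
      ketbra (probe_state p chi) (probe_state p chi) (\<alpha>, n) (\<beta>, m)"
  let ?s = "\<lambda>a. (y - a, z - a)"
  have inj: "inj_on ?s ({..y} \<inter> {..z})"
  proof (rule inj_onI)
    fix a b assume a: "a \<in> {..y} \<inter> {..z}" and b: "b \<in> {..y} \<inter> {..z}" and "?s a = ?s b"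
    then have eq: "y - a = y - b"
      by (simp only: prod.inject)
    have "a = y - (y - a)"
      by (rule diff_diff_fun[symmetric]) (use a in blast)
    also have "\<dots> = b"
      unfolding eq by (rule diff_diff_fun) (use b in blast)
    finally show "a = b" .
  qed
  have "output_state p chi ((cosh t)\<^sup>2) i j = infsum ?h UNIV"
    by (simp add: output_state_def id_tensor_power_def ij)
  also have "\<dots> = sum ?h (?s ` ({..y} \<inter> {..z}))"
  proof (rule infsumI, rule has_sum_finite_neutralI)
    show "?h k = 0" if "k \<in> UNIV - ?s ` ({..y} \<inter> {..z})" for k
    proof (cases k)
      case (Pair n m)
      have outside: "\<not> (n \<le> y \<and> m \<le> z \<and> y - n = z - m)"
      proof
        assume *: "n \<le> y \<and> m \<le> z \<and> y - n = z - m"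
        have "y - (y - n) = n"
          by (rule diff_diff_fun) (use * in blast)
        moreover have "z - (y - n) = m"
          using * diff_diff_fun[of m z] by simp
        ultimately have "k = ?s (y - n)"
          by (simp only: Pair)
        with that show False
          using diff_le_fun[of y n] diff_le_fun[of z m] * by auto
      qed
      show ?thesis
        unfolding Pair case_prod_conv prod_amplifier_matrix_unit[OF assms] if_not_P[OF outside]
        by (rule mult_zero_left)
    qed
  qed (rule finite_imageI, rule finite_Int, rule disjI1, rule finite_atMost_fun, rule subset_UNIV, rule refl)
  also have "\<dots> = (\<Sum>a\<in>{..y} \<inter> {..z}. ?h (?s a))"
    using sum.reindex[OF inj, of ?h] by (simp only: o_def)
  also have "\<dots> = (\<Sum>a\<in>{..y} \<inter> {..z}. branch ?q a i * cnj (branch ?q a j))"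
    unfolding case_prod_conv prod_amplifier_matrix_unit[OF assms] ketbra_def[of "probe_state p chi"]
    by (rule sum.cong) (auto simp: ij branch_apply probe_state_apply fun_arith probe_amplitude_def)
  \<comment> \<open>The added terms have a not below z, where branch a vanishes at j.\<close>
  also have "\<dots> = (\<Sum>a\<le>y. branch ?q a i * cnj (branch ?q a j))"
    by (rule sum.mono_neutral_left) (auto simp: ij branch_apply finite_atMost_fun)
  also have "\<dots> = mixture ?q (\<lambda>_. 1) i j"
    by (simp add: mixture_def ij)
  finally show "output_state p chi ((cosh t)\<^sup>2) i j = mixture ?q (\<lambda>_. 1) i j" .
qed

text \<open>The outcome (n, y) overlaps only the branch a = y - n. No two branches contribute to the
  same outcome, so the probability is a single squared coefficient.\<close>

lemma joint_distribution_mixture: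
  assumes "((\<lambda>k. (q k)\<^sup>2) has_sum 1) UNIV"
  shows "joint_distribution chi (mixture q (\<lambda>_. 1)) = (\<lambda>(n, y). if n \<le> y then (q (n, y - n))\<^sup>2 else 0)"
proof (intro ext)
  fix k :: "('m \<Rightarrow> nat) \<times> ('m \<Rightarrow> nat)"
  interpret branches chi q
    by unfold_locales (rule assms)
  obtain n y where k: "k = (n, y)" by (cases k)
  let ?v = "tensor (chi n) (ket y)"
  have v: "?v \<in> ell2"
    by (rule tensor_ket_in_ell2[OF chi_in_ell2])
  have "cinner (branch q a) ?v = (if n \<le> y \<and> y - n = a then complex_of_real (q (n, a)) else 0)" for a
    by (subst cinner_commute) (simp add: cinner_tensor_ket branch_def cinner_chi_embed_slice)
  then have "cinner ?v (mat_app (mixture q (\<lambda>_. 1)) ?v) =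
      complex_of_real (if n \<le> y then (q (n, y - n))\<^sup>2 else 0)"
    by (simp add: mixture_app[OF v] cinner_tensor_ket cinner_chi_embed_slice power2_eq_square)
  then show "joint_distribution chi (mixture q (\<lambda>_. 1)) k = (case k of (n, y) \<Rightarrow> if n \<le> y then (q (n, y - n))\<^sup>2 else 0)"
    by (simp add: joint_distribution_def Let_def k)
qed

end

text \<open>Recording y instead of a is an injective relabelling; outcomes outside its image satisfy
  not n \<le> y and carry the value 0.\<close>

lemma has_sum_outcomes:
  fixes h :: "('m \<Rightarrow> nat) \<times> ('m \<Rightarrow> nat) \<Rightarrow> real"
  assumes "(h has_sum S) UNIV"
  shows "((\<lambda>(n, y). if n \<le> y then h (n, y - n) else 0) has_sum S) UNIV"
proof -
  have "(h has_sum S) UNIV \<longleftrightarrow> ((\<lambda>(n, y). h (n, y - n)) has_sum S) {(n, y). n \<le> y}"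
    by (rule has_sum_reindex_bij_witness[of _ "\<lambda>(n, y). (n, y - n)" "\<lambda>(n, a). (n, n + a)"])
      (auto simp: fun_arith)
  also have "\<dots> \<longleftrightarrow> ((\<lambda>(n, y). if n \<le> y then h (n, y - n) else 0) has_sum S) UNIV"
    by (rule has_sum_cong_neutral) auto
  finally show ?thesis using assms by simp
qed

text \<open>Since \<open>\<mu>\<close> / 2 is the logarithmic derivative of the amplitude,
  \<open>\<mu>\<close> is that of the probability q^2.\<close>

lemma classical_fisher_information_outcomes:
  fixes q :: "real \<Rightarrow> ('m \<Rightarrow> nat) \<times> ('m \<Rightarrow> nat) \<Rightarrow> real"
  assumes normalized: "\<forall>\<^sub>F t in nhds \<tau>. ((\<lambda>k. (q t k)\<^sup>2) has_sum 1) UNIV"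
    and P: "\<forall>\<^sub>F t in nhds \<tau>. P t = (\<lambda>(n, y). if n \<le> y then (q t (n, y - n))\<^sup>2 else 0)"
    and deriv: "\<And>k. ((\<lambda>t. q t k) has_field_derivative \<mu> k / 2 * q \<tau> k) (at \<tau>)"
    and J: "((\<lambda>k. (\<mu> k * q \<tau> k)\<^sup>2) has_sum J) UNIV"
  shows "has_classical_fisher_information P \<tau> J"
proof -
  define p where "p t k = (q t k)\<^sup>2" for t k
  have P\<tau>: "P \<tau> = (\<lambda>(n, y). if n \<le> y then p \<tau> (n, y - n) else 0)"
    unfolding p_def by (rule eventually_nhds_x_imp_x[OF P])
  have Pt: "\<forall>\<^sub>F t in nhds \<tau>. P t (n, y) = (if n \<le> y then p t (n, y - n) else 0)" for n y
    using P by eventually_elim (simp add: p_def)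
  have p': "((\<lambda>t. p t k) has_field_derivative \<mu> k * p \<tau> k) (at \<tau>)" for k
    unfolding p_def power2_eq_square
    using DERIV_mult[OF deriv[of k] deriv[of k]] by (simp add: algebra_simps)
  have P': "((\<lambda>t. P t (n, y)) has_field_derivative (if n \<le> y then \<mu> (n, y - n) * p \<tau> (n, y - n) else 0)) (at \<tau>)" for n y
    unfolding DERIV_cong_ev[OF refl Pt refl] using p' by simp
  have "P \<tau> z * (deriv (\<lambda>t. ln (P t z)) \<tau>)\<^sup>2 =
      (case z of (n, y) \<Rightarrow> if n \<le> y then (\<mu> (n, y - n) * q \<tau> (n, y - n))\<^sup>2 else 0)" for z
  proof (cases z)
    case (Pair n y)
    show ?thesis
    \<comment> \<open>Where the probability is zero at \<tau>, the prefactor cancels whatever value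
      the derivative of the logarithm takes, and the right-hand side is zero too.\<close>
    proof (cases "n \<le> y \<and> q \<tau> (n, y - n) \<noteq> 0")
      case True
      then have pos: "P \<tau> (n, y) > 0"
        by (simp add: P\<tau> p_def)
      have "((\<lambda>t. ln (P t (n, y))) has_field_derivative \<mu> (n, y - n)) (at \<tau>)"
        using DERIV_chain2[OF DERIV_ln[OF pos] P'[of n y]] True pos
        by (simp add: P\<tau> field_simps)
      then have "deriv (\<lambda>t. ln (P t (n, y))) \<tau> = \<mu> (n, y - n)"
        by (rule DERIV_imp_deriv)
      then show ?thesis
        using True by (simp add: Pair P\<tau> p_def power_mult_distrib)
    next
      case False
      then show ?thesis by (auto simp: Pair P\<tau> p_def)
    qed
  qed
  moreover have "is_pmf (P t)" if "((\<lambda>k. (q t k)\<^sup>2) has_sum 1) UNIV"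
    "P t = (\<lambda>(n, y). if n \<le> y then (q t (n, y - n))\<^sup>2 else 0)" for t
    using has_sum_outcomes[OF that(1)] by (auto simp: is_pmf_def that(2))
  moreover have "(\<lambda>t. P t z) differentiable (at \<tau>)" for z
    using P' by (cases z) (auto simp: real_differentiable_def)
  ultimately show ?thesis
    unfolding has_classical_fisher_information_def
    using eventually_elim2[OF normalized P, of "\<lambda>t. is_pmf (P t)"] has_sum_outcomes[OF J] by simp
qed

theorem mainTheorem7:
  fixes p :: "('m::finite \<Rightarrow> nat) \<Rightarrow> real"
    and chi :: "('m \<Rightarrow> nat) \<Rightarrow> 'a \<Rightarrow> complex"
    and N \<tau> :: real
  assumes "N \<ge> 0" and "\<tau> > 0"
    and "orthonormal_family chi"
    and "is_pmf p"
    and "((\<lambda>n. p n * real (\<Sum>i\<in>UNIV. n i)) has_sum N) UNIV"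
  shows "has_classical_fisher_information
           (\<lambda>t. joint_distribution chi (output_state p chi ((cosh t)\<^sup>2))) \<tau>
           (4 * (N + real CARD('m))) \<and>
         has_quantum_fisher_information
           (\<lambda>t. output_state p chi ((cosh t)\<^sup>2)) \<tau>
           (4 * (N + real CARD('m)))"
proof -
  interpret ancilla_basis chi
    by unfold_locales (rule assms(3))
  let ?q = "probe_amplitude p" and ?\<mu> = "\<lambda>k :: ('m \<Rightarrow> nat) \<times> ('m \<Rightarrow> nat). 2 * total_score \<tau> k"
  \<comment> \<open>The formulas for the amplitudes hold for positive parameters, and both
    informations need the family only near \<tau>.\<close>
  have pos: "\<forall>\<^sub>F t in nhds \<tau>. t > 0"
    using eventually_nhds_in_open[of "{0<..}" \<tau>] assms(2) by simp
  have deriv: "((\<lambda>t. ?q t k) has_field_derivative ?\<mu> k / 2 * ?q \<tau> k) (at \<tau>)" for k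
    using probe_amplitude_has_derivative[OF assms(2)] by simp
  note fisher = probe_amplitude_fisher[OF assms(4,2,5)]
  have state: "\<forall>\<^sub>F t in nhds \<tau>. output_state p chi ((cosh t)\<^sup>2) = mixture (?q t) (\<lambda>_. 1)"
    using pos by eventually_elim (simp add: output_state_mixture)
  have "has_quantum_fisher_information (\<lambda>t. output_state p chi ((cosh t)\<^sup>2)) \<tau> (4 * (N + real CARD('m)))"
    by (rule has_quantum_fisher_information_cong[OF quantum_fisher_information_mixture
          [OF probe_amplitude_normalized[OF assms(4,2)] deriv fisher] state])
  moreover have "has_classical_fisher_information
      (\<lambda>t. joint_distribution chi (output_state p chi ((cosh t)\<^sup>2))) \<tau> (4 * (N + real CARD('m)))"
  proof (rule classical_fisher_information_outcomes[OF _ _ deriv fisher])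
    show norm: "\<forall>\<^sub>F t in nhds \<tau>. ((\<lambda>k. (?q t k)\<^sup>2) has_sum 1) UNIV"
      using pos by eventually_elim (rule probe_amplitude_normalized[OF assms(4)])
    show "\<forall>\<^sub>F t in nhds \<tau>. joint_distribution chi (output_state p chi ((cosh t)\<^sup>2)) =
        (\<lambda>(n, y). if n \<le> y then (?q t (n, y - n))\<^sup>2 else 0)"
      using state norm by eventually_elim (simp add: joint_distribution_mixture)
  qed
  ultimately show ?thesis by blast
qed

end
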